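(* Let $H$ be a weak bialgebra over the field $k$, and let $R=H_t$. Then the following are equivalent: (1) $H$ is a weak Hopf algebra. (2) The $\times_R$-bialgebra $(H,\Gamma,C)$ associated to $H$ is a $\times_R$-Hopf algebra.
   Context: $k$ is a field; algebras (unital, associative), coalgebras, $\otimes$ are over $k$; Sweedler notation $\Delta(h)=h_{(1)}\otimes h_{(2)}$, and $1_{(1)}\otimes 1_{(2)}=\Delta(1)$. Weak bialgebra: an algebra and coalgebra $H$ with $\Delta(gh)=\Delta(g)\Delta(h)$ and, for all $f,g,h\in H$: $\epsilon(fgh)=\epsilon(fg_{(1)})\epsilon(g_{(2)}h)=\epsilon(fg_{(2)})\epsilon(g_{(1)}h)$, and $1_{(1)}\otimes1_{(2)}\otimes1_{(3)}=(\Delta(1)\otimes1)(1\otimes\Delta(1))=(1\otimes\Delta(1))(\Delta(1)\otimes1)$. Counital maps: $\epsilon_s(h)=1_{(1)}\epsilon(h1_{(2)})$, $\epsilon_t(h)=\epsilon(1_{(1)}h)1_{(2)}$, $\epsilon_s'(h)=1_{(1)}\epsilon(1_{(2)}h)$. $H_s=\epsilon_s(H)$ and $H_t=\epsilon_t(H)$ are the source and target counital subalgebras; they are subalgebras of $H$ which commute elementwise. Weak Hopf algebra: a weak bialgebra $H$ for which there exists a $k$-linear map $S\colon H\to H$ with $S(h_{(1)})h_{(2)}=\epsilon_s(h)$, $h_{(1)}S(h_{(2)})=\epsilon_t(h)$ and $S(h_{(1)})h_{(2)}S(h_{(3)})=S(h)$ for all $h\in H$. $\times_R$-bialgebras: Let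 $R$ be a $k$-algebra, $\overline R$ its opposite algebra, $r\mapsto\overline r$ the canonical anti-isomorphism $R\to\overline R$, $R^e=R\otimes\overline R$, $r\overline s:=r\otimes\overline s$. An $R^e$-ring is a $k$-algebra $L$ with an algebra map $R^e\to L$; one writes $r,\overline s$ also for images in $L$. For left $R^e$-modules $M,N$, $M\diamond N:=M\otimes N/\langle\overline rm\otimes n-m\otimes rn\mid r\in R,m\in M,n\in N\rangle$. For $R^e$-bimodules $M,N$, $M\times_RN\subset M\diamond N$ is the subspace of all $\sum m_i\otimes n_i$ with $\sum m_i\overline s\otimes n_i=\sum m_i\otimes n_is$ for all $s\in R$; if $M,N$ are $R^e$-rings, it is an $R^e$-ring with factorwise multiplication and structure map $r\otimes\overline s\mapsto r\otimes\overline s$. $\operatorname{End}(R)$ ($k$-linear endomorphisms) is an $R^e$-ring via $r\otimes\overline s\mapsto(t\mapsto rts)$. A $\times_R$-bialgebra is an $R^e$-ring $L$ with homomorphisms of $R^e$-rings $\Gamma\colon L\to L\times_RL$, $\Gamma(\ell)=\ell_{[1]}\otimes\ell_{[2]}$, and $C\colon L\to\operatorname{End}(R)$ such that the induced map $\Gamma_0\colon L\to L\diamond L$ is coassociative, $(\Gamma_0\diamond L)\Gamma_0=(L\diamond\Gamma_0)\Gamma_0$, and $\overline{C(\ell_{[2]})(1)}\,\ell_{[1]}=\ell=C(\ell_{[1]})(1)\,\ell_{[2]}$ for all $\ell\in L$. A $\times_R$-bialgebra $L$ is a $\times_R$-Hopf algebra if the canonical map $L\otimes_{\overline R}L\to L\diamond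 L$, $g\otimes h\mapsto g_{[1]}\otimes g_{[2]}h$, is bijective; here $L\otimes_{\overline R}L$ is formed using right and left multiplication by elements $\overline r$, i.e. $g\overline r\otimes h=g\otimes\overline rh$. Associated $\times_R$-bialgebra of a weak bialgebra $H$: $R=H_t$; the $R^e$-ring structure on $H$ is $x\otimes\overline y\mapsto x\,\epsilon_s'(y)$; $\Gamma$ is the composition of $\Delta$ with the canonical surjection $H\otimes H\to H\diamond H$ (it takes values in $H\times_RH$); and $C(h)(x)=\epsilon_t(hx)$. This is indeed a $\times_R$-bialgebra, and $\overline R=H_s$ inside $H$. *)

theory Defs
  imports Complex_Main "HOL-Library.Poly_Mapping" "HOL-Library.Set_Algebras"
begin

section \<open>Tensor products over a field\<close>

text \<open>
  Everything lives over a field, given as a type \<open>'k\<close>. A tensor product is the quotient of the free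
  vector space \<open>('a \<times> 'b) \<Rightarrow>\<^sub>0 'k\<close> of formal combinations of pairs by the subspace \<open>W\<close> spanned by the
  required relations. Its elements are the cosets \<open>x +o W\<close>.
\<close>

abbreviation pure :: "'a \<Rightarrow> 'a \<Rightarrow>\<^sub>0 'k::field"
  where "pure p \<equiv> Poly_Mapping.single p 1"

definition fscale :: "'k::field \<Rightarrow> ('a \<Rightarrow>\<^sub>0 'k) \<Rightarrow> ('a \<Rightarrow>\<^sub>0 'k)"
  where "fscale c x = Poly_Mapping.map ((*) c) x"

lemma lookup_fscale [simp]: "Poly_Mapping.lookup (fscale c x) p = c * Poly_Mapping.lookup x p"
  by (auto simp: fscale_def Poly_Mapping.map.rep_eq when_def)

global_interpretation free_space: vector_space fscale
  by unfold_locales (auto intro!: poly_mapping_eqI simp: lookup_add algebra_simps)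

definition lin_ext :: "('k::field \<Rightarrow> 'v \<Rightarrow> 'v) \<Rightarrow> ('a \<Rightarrow> 'v) \<Rightarrow> ('a \<Rightarrow>\<^sub>0 'k) \<Rightarrow> 'v::ab_group_add"
  where "lin_ext s f x = (\<Sum>p\<in>Poly_Mapping.keys x. s (Poly_Mapping.lookup x p) (f p))"

definition formal_mult :: "('a \<Rightarrow> 'a \<Rightarrow> 'a) \<Rightarrow> ('a \<Rightarrow>\<^sub>0 'k::field) \<Rightarrow> ('a \<Rightarrow>\<^sub>0 'k) \<Rightarrow> ('a \<Rightarrow>\<^sub>0 'k)"
  where "formal_mult m x y = lin_ext fscale (\<lambda>p. lin_ext fscale (\<lambda>q. pure (m p q)) y) x"

fun mult2 :: "'a::times \<times> 'b::times \<Rightarrow> 'a \<times> 'b \<Rightarrow> 'a \<times> 'b"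
  where "mult2 (a, b) (a', b') = (a * a', b * b')"

fun mult3 :: "'a::times \<times> 'b::times \<times> 'c::times \<Rightarrow> 'a \<times> 'b \<times> 'c \<Rightarrow> 'a \<times> 'b \<times> 'c"
  where "mult3 (a, b, c) (a', b', c') = (a * a', b * b', c * c')"

text \<open>
  A choice of a formal combination representing an element of a quotient, that is, of a way to write
  an element of a tensor product as a sum of pure tensors. It plays the role of Sweedler notation:
  wherever it is used below, the result does not depend on the choice.
\<close>

definition rep :: "'a set \<Rightarrow> 'a"
  where "rep X = (SOME x. x \<in> X)"

definition formal_on :: "'a set \<Rightarrow> 'b set \<Rightarrow> ('a \<times> 'b \<Rightarrow>\<^sub>0 'k::field) set"
  where "formal_on A B = {x. Poly_Mapping.keys x \<subseteq> A \<times> B}"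

definition bilinear_relators ::
    "('k::field \<Rightarrow> 'a::ab_group_add \<Rightarrow> 'a) \<Rightarrow> 'a set \<Rightarrow> ('k \<Rightarrow> 'b::ab_group_add \<Rightarrow> 'b) \<Rightarrow> 'b set
      \<Rightarrow> ('a \<times> 'b \<Rightarrow>\<^sub>0 'k) set"
  where "bilinear_relators sA A sB B =
      {pure (a + a', b) - pure (a, b) - pure (a', b) | a a' b. a \<in> A \<and> a' \<in> A \<and> b \<in> B}
    \<union> {pure (a, b + b') - pure (a, b) - pure (a, b') | a b b'. a \<in> A \<and> b \<in> B \<and> b' \<in> B}
    \<union> {pure (sA c a, b) - fscale c (pure (a, b)) | c a b. a \<in> A \<and> b \<in> B}
    \<union> {pure (a, sB c b) - fscale c (pure (a, b)) | c a b. a \<in> A \<and> b \<in> B}"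

definition trilinear_relators ::
    "('k::field \<Rightarrow> 'a::ab_group_add \<Rightarrow> 'a) \<Rightarrow> ('a \<times> 'a \<times> 'a \<Rightarrow>\<^sub>0 'k) set"
  where "trilinear_relators s =
      {pure (a + a', b, c) - pure (a, b, c) - pure (a', b, c) | a a' b c. True}
    \<union> {pure (a, b + b', c) - pure (a, b, c) - pure (a, b', c) | a b b' c. True}
    \<union> {pure (a, b, c + c') - pure (a, b, c) - pure (a, b, c') | a b c c'. True}
    \<union> {pure (s t a, b, c) - fscale t (pure (a, b, c)) | t a b c. True}
    \<union> {pure (a, s t b, c) - fscale t (pure (a, b, c)) | t a b c. True}
    \<union> {pure (a, b, s t c) - fscale t (pure (a, b, c)) | t a b c. True}"

text \<open>The relation spaces defining \<open>V \<otimes> V\<close> and \<open>V \<otimes> V \<otimes> V\<close>.\<close>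

definition rel2 :: "('k::field \<Rightarrow> 'a::ab_group_add \<Rightarrow> 'a) \<Rightarrow> ('a \<times> 'a \<Rightarrow>\<^sub>0 'k) set"
  where "rel2 s = free_space.span (bilinear_relators s UNIV s UNIV)"

definition rel3 :: "('k::field \<Rightarrow> 'a::ab_group_add \<Rightarrow> 'a) \<Rightarrow> ('a \<times> 'a \<times> 'a \<Rightarrow>\<^sub>0 'k) set"
  where "rel3 s = free_space.span (trilinear_relators s)"

text \<open>
  For a map \<open>D\<close> into a quotient of the formal combinations of pairs, representatives of
  \<open>(D \<otimes> id) (D h)\<close> and \<open>(id \<otimes> D) (D h)\<close>.
\<close>

definition iter_left :: "('a \<Rightarrow> ('a \<times> 'a \<Rightarrow>\<^sub>0 'k::field) set) \<Rightarrow> 'a \<Rightarrow> ('a \<times> 'a \<times> 'a \<Rightarrow>\<^sub>0 'k)"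
  where "iter_left D h =
    lin_ext fscale (\<lambda>(a, b). lin_ext fscale (\<lambda>(a1, a2). pure (a1, a2, b)) (rep (D a))) (rep (D h))"

definition iter_right :: "('a \<Rightarrow> ('a \<times> 'a \<Rightarrow>\<^sub>0 'k::field) set) \<Rightarrow> 'a \<Rightarrow> ('a \<times> 'a \<times> 'a \<Rightarrow>\<^sub>0 'k)"
  where "iter_right D h =
    lin_ext fscale (\<lambda>(a, b). lin_ext fscale (\<lambda>(b1, b2). pure (a, b1, b2)) (rep (D b))) (rep (D h))"


section \<open>Weak bialgebras and weak Hopf algebras\<close>

text \<open>The sort \<^class>\<open>ring_1\<close> is avoided because it excludes the zero algebra.\<close>

locale k_algebra = vector_space scale
  for scale :: "'k::field \<Rightarrow> 'h::{ring, monoid_mult} \<Rightarrow> 'h" +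
  assumes scale_mult_left: "scale c x * y = scale c (x * y)"
    and scale_mult_right: "x * scale c y = scale c (x * y)"

locale k_coalgebra = vector_space scale
  for scale :: "'k::field \<Rightarrow> 'h::ab_group_add \<Rightarrow> 'h" +
  fixes \<Delta> :: "'h \<Rightarrow> ('h \<times> 'h \<Rightarrow>\<^sub>0 'k) set" and \<epsilon> :: "'h \<Rightarrow> 'k"
  assumes comult_tensor: "\<Delta> h \<in> range (\<lambda>x. x +o rel2 scale)"
    and comult_add: "\<Delta> (g + h) = (rep (\<Delta> g) + rep (\<Delta> h)) +o rel2 scale"
    and comult_scale: "\<Delta> (scale c h) = fscale c (rep (\<Delta> h)) +o rel2 scale"
    and counit_linear: "Vector_Spaces.linear scale (*) \<epsilon>"
    and coassoc: "iter_left \<Delta> h +o rel3 scale = iter_right \<Delta> h +o rel3 scale"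
    and counit_left: "lin_ext scale (\<lambda>(a, b). scale (\<epsilon> a) b) (rep (\<Delta> h)) = h"
    and counit_right: "lin_ext scale (\<lambda>(a, b). scale (\<epsilon> b) a) (rep (\<Delta> h)) = h"

locale weak_bialgebra = k_algebra scale + k_coalgebra scale \<Delta> \<epsilon>
  for scale :: "'k::field \<Rightarrow> 'h::{ring, monoid_mult} \<Rightarrow> 'h"
    and \<Delta> :: "'h \<Rightarrow> ('h \<times> 'h \<Rightarrow>\<^sub>0 'k) set" and \<epsilon> :: "'h \<Rightarrow> 'k" +
  assumes comult_mult:
      "\<Delta> (g * h) = formal_mult mult2 (rep (\<Delta> g)) (rep (\<Delta> h)) +o rel2 scale"
    and counit_mult1:
      "\<epsilon> (f * g * h) = lin_ext (*) (\<lambda>(g1, g2). \<epsilon> (f * g1) * \<epsilon> (g2 * h)) (rep (\<Delta> g))"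
    and counit_mult2:
      "\<epsilon> (f * g * h) = lin_ext (*) (\<lambda>(g1, g2). \<epsilon> (f * g2) * \<epsilon> (g1 * h)) (rep (\<Delta> g))"
    and comult_one1:
      "iter_left \<Delta> 1 +o rel3 scale =
         formal_mult mult3 (lin_ext fscale (\<lambda>(a, b). pure (a, b, 1)) (rep (\<Delta> 1)))
           (lin_ext fscale (\<lambda>(a, b). pure (1, a, b)) (rep (\<Delta> 1))) +o rel3 scale"
    and comult_one2:
      "iter_left \<Delta> 1 +o rel3 scale =
         formal_mult mult3 (lin_ext fscale (\<lambda>(a, b). pure (1, a, b)) (rep (\<Delta> 1)))
           (lin_ext fscale (\<lambda>(a, b). pure (a, b, 1)) (rep (\<Delta> 1))) +o rel3 scale"

locale counital_maps =
  fixes scale :: "'k::field \<Rightarrow> 'h::{ring, monoid_mult} \<Rightarrow> 'h"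
    and \<Delta> :: "'h \<Rightarrow> ('h \<times> 'h \<Rightarrow>\<^sub>0 'k) set" and \<epsilon> :: "'h \<Rightarrow> 'k"
begin

definition \<epsilon>s :: "'h \<Rightarrow> 'h"
  where "\<epsilon>s h = lin_ext scale (\<lambda>(a, b). scale (\<epsilon> (h * b)) a) (rep (\<Delta> 1))"

definition \<epsilon>t :: "'h \<Rightarrow> 'h"
  where "\<epsilon>t h = lin_ext scale (\<lambda>(a, b). scale (\<epsilon> (a * h)) b) (rep (\<Delta> 1))"

definition \<epsilon>s' :: "'h \<Rightarrow> 'h"
  where "\<epsilon>s' h = lin_ext scale (\<lambda>(a, b). scale (\<epsilon> (b * h)) a) (rep (\<Delta> 1))"

definition target_subalgebra :: "'h set"
  where "target_subalgebra = range \<epsilon>t"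

end

locale weak_hopf_algebra = weak_bialgebra scale \<Delta> \<epsilon> + counital_maps scale \<Delta> \<epsilon>
  for scale :: "'k::field \<Rightarrow> 'h::{ring, monoid_mult} \<Rightarrow> 'h"
    and \<Delta> :: "'h \<Rightarrow> ('h \<times> 'h \<Rightarrow>\<^sub>0 'k) set" and \<epsilon> :: "'h \<Rightarrow> 'k" +
  assumes antipode_exists:
    "\<exists>S. Vector_Spaces.linear scale scale S \<and>
      (\<forall>h. lin_ext scale (\<lambda>(h1, h2). S h1 * h2) (rep (\<Delta> h)) = \<epsilon>s h) \<and>
      (\<forall>h. lin_ext scale (\<lambda>(h1, h2). h1 * S h2) (rep (\<Delta> h)) = \<epsilon>t h) \<and>
      (\<forall>h. lin_ext scale (\<lambda>(h1, h2, h3). S h1 * h2 * S h3) (iter_left \<Delta> h) = S h)"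


section \<open>Bialgebras and Hopf algebras over a noncommutative base\<close>

text \<open>
  The base algebra is a unital subalgebra \<open>R\<close> of an algebra of type \<open>'r\<close>. Since \<open>R\<close> and its
  opposite have the same elements, \<open>R \<otimes> R\<^sup>o\<^sup>p\<close> is built from pairs of elements of \<open>R\<close>, the second
  factor being multiplied in reverse order. The structure map \<open>\<eta>\<close> of an \<open>R \<otimes> R\<^sup>o\<^sup>p\<close>-ring is
  relevant only on cosets of \<open>Re_rel\<close>, and the endomorphism \<open>C l\<close> only on \<open>R\<close>.
\<close>

locale xR_data =
  fixes scaleR :: "'k::field \<Rightarrow> 'r::{ring, monoid_mult} \<Rightarrow> 'r" and R :: "'r set"
    and scale :: "'k \<Rightarrow> 'l::{ring, monoid_mult} \<Rightarrow> 'l"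
    and \<eta> :: "('r \<times> 'r \<Rightarrow>\<^sub>0 'k) set \<Rightarrow> 'l"
    and \<Gamma> :: "'l \<Rightarrow> ('l \<times> 'l \<Rightarrow>\<^sub>0 'k) set"
    and C :: "'l \<Rightarrow> 'r \<Rightarrow> 'r"
begin

definition Re_rel :: "('r \<times> 'r \<Rightarrow>\<^sub>0 'k) set"
  where "Re_rel = free_space.span (bilinear_relators scaleR R scaleR R)"

text \<open>The images in \<open>L\<close> of an element of \<open>R\<close> and of the corresponding element of the opposite of \<open>R\<close>.\<close>

definition base :: "'r \<Rightarrow> 'l"
  where "base r = \<eta> (pure (r, 1) +o Re_rel)"

definition base_op :: "'r \<Rightarrow> 'l"
  where "base_op r = \<eta> (pure (1, r) +o Re_rel)"

text \<open>The products \<open>L \<diamond> L\<close> and \<open>L \<diamond> L \<diamond> L\<close>, with bilinearity and balancing relations imposed at once.\<close>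

definition diamond_rel :: "('l \<times> 'l \<Rightarrow>\<^sub>0 'k) set"
  where "diamond_rel = free_space.span (bilinear_relators scale UNIV scale UNIV
    \<union> {pure (base_op r * m, n) - pure (m, base r * n) | r m n. r \<in> R})"

definition diamond :: "('l \<times> 'l \<Rightarrow>\<^sub>0 'k) set set"
  where "diamond = range (\<lambda>x. x +o diamond_rel)"

definition diamond3_rel :: "('l \<times> 'l \<times> 'l \<Rightarrow>\<^sub>0 'k) set"
  where "diamond3_rel = free_space.span (trilinear_relators scale
    \<union> {pure (base_op r * m, n, p) - pure (m, base r * n, p) | r m n p. r \<in> R}
    \<union> {pure (m, base_op r * n, p) - pure (m, n, base r * p) | r m n p. r \<in> R})"

definition xR_product :: "('l \<times> 'l \<Rightarrow>\<^sub>0 'k) set set"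
  where "xR_product = {X \<in> diamond. \<forall>s\<in>R.
    lin_ext fscale (\<lambda>(m, n). pure (m * base_op s, n)) (rep X) +o diamond_rel =
    lin_ext fscale (\<lambda>(m, n). pure (m, n * base s)) (rep X) +o diamond_rel}"

text \<open>The tensor product of \<open>L\<close> with itself over the opposite of \<open>R\<close>.\<close>

definition op_tensor_rel :: "('l \<times> 'l \<Rightarrow>\<^sub>0 'k) set"
  where "op_tensor_rel = free_space.span (bilinear_relators scale UNIV scale UNIV
    \<union> {pure (g * base_op r, h) - pure (g, base_op r * h) | r g h. r \<in> R})"

definition op_tensor :: "('l \<times> 'l \<Rightarrow>\<^sub>0 'k) set set"
  where "op_tensor = range (\<lambda>x. x +o op_tensor_rel)"

definition canonical_map :: "('l \<times> 'l \<Rightarrow>\<^sub>0 'k) set \<Rightarrow> ('l \<times> 'l \<Rightarrow>\<^sub>0 'k) set"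
  where "canonical_map X =
    lin_ext fscale (\<lambda>(g, h). lin_ext fscale (\<lambda>(g1, g2). pure (g1, g2 * h)) (rep (\<Gamma> g))) (rep X)
      +o diamond_rel"

end

locale Re_ring = xR_data scaleR R scale \<eta> \<Gamma> C + R: k_algebra scaleR + L: k_algebra scale
  for scaleR :: "'k::field \<Rightarrow> 'r::{ring, monoid_mult} \<Rightarrow> 'r" and R :: "'r set"
    and scale :: "'k \<Rightarrow> 'l::{ring, monoid_mult} \<Rightarrow> 'l"
    and \<eta> :: "('r \<times> 'r \<Rightarrow>\<^sub>0 'k) set \<Rightarrow> 'l"
    and \<Gamma> :: "'l \<Rightarrow> ('l \<times> 'l \<Rightarrow>\<^sub>0 'k) set"
    and C :: "'l \<Rightarrow> 'r \<Rightarrow> 'r" +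
  assumes R_subspace: "R.subspace R"
    and R_one: "1 \<in> R"
    and R_mult: "r \<in> R \<Longrightarrow> s \<in> R \<Longrightarrow> r * s \<in> R"
    and eta_add: "x \<in> formal_on R R \<Longrightarrow> y \<in> formal_on R R \<Longrightarrow>
      \<eta> ((x + y) +o Re_rel) = \<eta> (x +o Re_rel) + \<eta> (y +o Re_rel)"
    and eta_scale: "x \<in> formal_on R R \<Longrightarrow> \<eta> (fscale c x +o Re_rel) = scale c (\<eta> (x +o Re_rel))"
    and eta_one: "\<eta> (pure (1, 1) +o Re_rel) = 1"
    and eta_mult: "x \<in> formal_on R R \<Longrightarrow> y \<in> formal_on R R \<Longrightarrow>
      \<eta> (formal_mult (\<lambda>(r, s) (r', s'). (r * r', s' * s)) x y +o Re_rel) =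
      \<eta> (x +o Re_rel) * \<eta> (y +o Re_rel)"

locale xR_bialgebra = Re_ring scaleR R scale \<eta> \<Gamma> C
  for scaleR :: "'k::field \<Rightarrow> 'r::{ring, monoid_mult} \<Rightarrow> 'r" and R :: "'r set"
    and scale :: "'k \<Rightarrow> 'l::{ring, monoid_mult} \<Rightarrow> 'l"
    and \<eta> :: "('r \<times> 'r \<Rightarrow>\<^sub>0 'k) set \<Rightarrow> 'l"
    and \<Gamma> :: "'l \<Rightarrow> ('l \<times> 'l \<Rightarrow>\<^sub>0 'k) set"
    and C :: "'l \<Rightarrow> 'r \<Rightarrow> 'r" +
  assumes Gamma_xR: "\<Gamma> l \<in> xR_product"
    and Gamma_add: "\<Gamma> (g + h) = (rep (\<Gamma> g) + rep (\<Gamma> h)) +o diamond_rel"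
    and Gamma_scale: "\<Gamma> (scale c h) = fscale c (rep (\<Gamma> h)) +o diamond_rel"
    and Gamma_one: "\<Gamma> 1 = pure (1, 1) +o diamond_rel"
    and Gamma_mult: "\<Gamma> (g * h) = formal_mult mult2 (rep (\<Gamma> g)) (rep (\<Gamma> h)) +o diamond_rel"
    and Gamma_eta: "x \<in> formal_on R R \<Longrightarrow> \<Gamma> (\<eta> (x +o Re_rel)) =
      lin_ext fscale (\<lambda>(r, s). pure (base r, base_op s)) x +o diamond_rel"
    and C_mem: "t \<in> R \<Longrightarrow> C l t \<in> R"
    and C_add_arg: "t \<in> R \<Longrightarrow> t' \<in> R \<Longrightarrow> C l (t + t') = C l t + C l t'"
    and C_scale_arg: "t \<in> R \<Longrightarrow> C l (scaleR c t) = scaleR c (C l t)"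
    and C_add: "t \<in> R \<Longrightarrow> C (g + h) t = C g t + C h t"
    and C_scale: "t \<in> R \<Longrightarrow> C (scale c h) t = scaleR c (C h t)"
    and C_one: "t \<in> R \<Longrightarrow> C 1 t = t"
    and C_mult: "t \<in> R \<Longrightarrow> C (g * h) t = C g (C h t)"
    and C_eta: "x \<in> formal_on R R \<Longrightarrow> t \<in> R \<Longrightarrow>
      C (\<eta> (x +o Re_rel)) t = lin_ext scaleR (\<lambda>(r, s). r * t * s) x"
    and Gamma_coassoc: "iter_left \<Gamma> l +o diamond3_rel = iter_right \<Gamma> l +o diamond3_rel"
    and Gamma_counit1: "lin_ext scale (\<lambda>(l1, l2). base_op (C l2 1) * l1) (rep (\<Gamma> l)) = l"
    and Gamma_counit2: "lin_ext scale (\<lambda>(l1, l2). base (C l1 1) * l2) (rep (\<Gamma> l)) = l"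

locale xR_hopf_algebra = xR_bialgebra scaleR R scale \<eta> \<Gamma> C
  for scaleR :: "'k::field \<Rightarrow> 'r::{ring, monoid_mult} \<Rightarrow> 'r" and R :: "'r set"
    and scale :: "'k \<Rightarrow> 'l::{ring, monoid_mult} \<Rightarrow> 'l"
    and \<eta> :: "('r \<times> 'r \<Rightarrow>\<^sub>0 'k) set \<Rightarrow> 'l"
    and \<Gamma> :: "'l \<Rightarrow> ('l \<times> 'l \<Rightarrow>\<^sub>0 'k) set"
    and C :: "'l \<Rightarrow> 'r \<Rightarrow> 'r" +
  assumes canonical_bij: "bij_betw canonical_map op_tensor diamond"


section \<open>The structure associated to a weak bialgebra\<close>

context counital_maps
begin

definition assoc_eta :: "('h \<times> 'h \<Rightarrow>\<^sub>0 'k) set \<Rightarrow> 'h"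
  where "assoc_eta X = lin_ext scale (\<lambda>(x, y). x * \<epsilon>s' y) (rep X)"

text \<open>The comultiplication followed by the surjection from \<open>H \<otimes> H\<close> to \<open>H \<diamond> H\<close>.\<close>

definition assoc_Gamma :: "'h \<Rightarrow> ('h \<times> 'h \<Rightarrow>\<^sub>0 'k) set"
  where "assoc_Gamma h =
    rep (\<Delta> h) +o xR_data.diamond_rel scale target_subalgebra scale assoc_eta"

definition assoc_C :: "'h \<Rightarrow> 'h \<Rightarrow> 'h"
  where "assoc_C h x = \<epsilon>t (h * x)"

end

end

theory Submission
  imports Defs
begin

text \<open>
  A formal combination is zero in a tensor product iff every multilinear (and suitably balanced)
  form annihilates it, so all identities are checked in \<open>k\<close>, with Sweedler notation becoming the
  scalar \<open>sw h f = f(h\<^sub>1, h\<^sub>2)\<close>.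

  If \<open>S\<close> is an antipode, then \<open>g \<otimes> h \<mapsto> g\<^sub>1 \<otimes> S(g\<^sub>2) h\<close> inverts the canonical map; it is balanced
  because \<open>S(\<epsilon>\<^sub>s'(r) m) = S(m) r\<close> for \<open>r \<in> H\<^sub>t\<close>.

  Conversely, let the canonical map \<open>\<beta>\<close> be bijective, write \<open>h\<^sub>+ \<otimes> h\<^sub>- = \<beta>\<^sup>-\<^sup>1(h \<otimes> 1)\<close> and put
  \<open>S(h) = \<epsilon>\<^sub>s(h\<^sub>+) h\<^sub>-\<close>. Right linearity of \<open>\<beta>\<^sup>-\<^sup>1\<close> gives \<open>S(h\<^sub>1) h\<^sub>2 = \<epsilon>\<^sub>s(h)\<close>. The left comodule
  property \<open>h\<^sub>1 \<otimes> h\<^sub>2\<^sub>+ \<otimes> h\<^sub>2\<^sub>- = h\<^sub>+\<^sub>1 \<otimes> h\<^sub>+\<^sub>2 \<otimes> h\<^sub>-\<close> already holds in \<open>H \<otimes> (H \<otimes>\<^bsub>Hs\<^esub> H)\<close>, with no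
  balancing between the first two factors; hence \<open>h\<^sub>1 S(h\<^sub>2) = h\<^sub>+ h\<^sub>- = \<epsilon>\<^sub>t(h)\<close> and
  \<open>\<epsilon>\<^sub>s(h\<^sub>1) S(h\<^sub>2) = S(h)\<close>.
\<close>

section \<open>Formal combinations and linear forms\<close>

lemma elt_set_plus_eq_iff_diff:
  assumes "free_space.subspace W"
  shows "x +o W = y +o W \<longleftrightarrow> x - y \<in> W"
proof
  assume "x +o W = y +o W"
  moreover have "x \<in> x +o W"
    using free_space.subspace_0[OF assms] by (force simp: elt_set_plus_def)
  ultimately obtain w where "w \<in> W" "x = y + w" by (auto simp: elt_set_plus_def)
  then show "x - y \<in> W" by simp
next
  assume xy: "x - y \<in> W"
  have "x +o W \<subseteq> y +o W" if "x - y \<in> W" for x y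
  proof
    fix z assume "z \<in> x +o W"
    then obtain w where "w \<in> W" "z = x + w" by (auto simp: elt_set_plus_def)
    then have "z = y + ((x - y) + w)" "(x - y) + w \<in> W"
      using that free_space.subspace_add[OF assms] by auto
    then show "z \<in> y +o W" unfolding elt_set_plus_def by blast
  qed
  moreover have "y - x \<in> W"
    using free_space.subspace_neg[OF assms xy] by simp
  ultimately show "x +o W = y +o W" using xy by blast
qed

text \<open>The chosen element lies in the coset, and nothing else about the choice is used;
  independence of \<open>rep\<close> always goes back to this.\<close>

lemma rep_coset:
  assumes "free_space.subspace W"
  shows "rep (x +o W) +o W = x +o W"
proof -
  have "x \<in> x +o W"
    using free_space.subspace_0[OF assms] by (force simp: elt_set_plus_def)
  then have "rep (x +o W) \<in> x +o W" unfolding rep_def by (rule someI)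
  then obtain w where "w \<in> W" "rep (x +o W) = x + w" by (auto simp: elt_set_plus_def)
  then show ?thesis by (simp add: elt_set_plus_eq_iff_diff[OF assms])
qed

definition lform :: "('k::field \<Rightarrow> 'v::ab_group_add \<Rightarrow> 'v) \<Rightarrow> ('v \<Rightarrow> 'k) \<Rightarrow> bool"
  where "lform s \<phi> \<longleftrightarrow> (\<forall>a b. \<phi> (a + b) = \<phi> a + \<phi> b) \<and> (\<forall>c a. \<phi> (s c a) = c * \<phi> a)"

section \<open>Linear extension and separation by linear forms\<close>

context vector_space
begin

lemma lin_ext_superset:
  assumes "finite A" "Poly_Mapping.keys x \<subseteq> A"
  shows "lin_ext scale f x = (\<Sum>p\<in>A. scale (Poly_Mapping.lookup x p) (f p))"
  unfolding lin_ext_def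
  by (rule sum.mono_neutral_left) (use assms in \<open>auto simp: in_keys_iff\<close>)

lemma lin_ext_pure [simp]: "lin_ext scale f (pure p) = f p"
  by (simp add: lin_ext_def)

lemma lin_ext_add: "lin_ext scale f (x + y) = lin_ext scale f x + lin_ext scale f y"
proof -
  let ?A = "Poly_Mapping.keys x \<union> Poly_Mapping.keys y"
  have "Poly_Mapping.keys (x + y) \<subseteq> ?A" by (rule Poly_Mapping.keys_add)
  then show ?thesis
    by (simp add: lin_ext_superset[of ?A] lookup_add scale_left_distrib sum.distrib)
qed

lemma lin_ext_fscale: "lin_ext scale f (fscale c x) = scale c (lin_ext scale f x)"
proof -
  have "Poly_Mapping.keys (fscale c x) \<subseteq> Poly_Mapping.keys x" by (auto simp: in_keys_iff)
  then show ?thesis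
    by (simp add: lin_ext_superset[of "Poly_Mapping.keys x"] scale_sum_right)
qed

lemma lin_ext_0 [simp]: "lin_ext scale f 0 = 0"
  by (simp add: lin_ext_def)

lemma lin_ext_diff: "lin_ext scale f (x - y) = lin_ext scale f x - lin_ext scale f y"
  using lin_ext_add[of f "x - y" y] by simp

lemma lin_ext_add_fun: "lin_ext scale (\<lambda>p. f p + g p) x = lin_ext scale f x + lin_ext scale g x"
  by (simp add: lin_ext_def scale_right_distrib sum.distrib)

lemma lin_ext_scale_fun: "lin_ext scale (\<lambda>p. scale c (f p)) x = scale c (lin_ext scale f x)"
  by (simp add: lin_ext_def scale_sum_right mult.commute)

lemma lin_ext_sum:
  "finite A \<Longrightarrow> lin_ext scale f (\<Sum>p\<in>A. g p) = (\<Sum>p\<in>A. lin_ext scale f (g p))"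
  by (induction A rule: finite_induct) (simp_all add: lin_ext_add)

text \<open>Sums nested in formal combinations flatten by linearity; this turns
  \<open>iter_left\<close>, \<open>formal_mult\<close> and the canonical map into iterated
  evaluations.\<close>

lemma lin_ext_lin_ext:
  "lin_ext scale f (lin_ext fscale g x) = lin_ext scale (\<lambda>p. lin_ext scale f (g p)) x"
proof -
  have "lin_ext scale f (lin_ext fscale g x)
      = (\<Sum>p\<in>Poly_Mapping.keys x. lin_ext scale f (fscale (Poly_Mapping.lookup x p) (g p)))"
    by (simp add: lin_ext_def[of fscale] lin_ext_sum)
  then show ?thesis by (simp add: lin_ext_fscale lin_ext_def[of scale "\<lambda>p. lin_ext scale f (g p)"])
qed

lemma lin_ext_cong:
  "(\<And>p. p \<in> Poly_Mapping.keys x \<Longrightarrow> f p = g p) \<Longrightarrow> lin_ext scale f x = lin_ext scale g x"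
  by (simp add: lin_ext_def)

lemma lin_ext_span_eq_0:
  assumes "x \<in> free_space.span B" "\<And>b. b \<in> B \<Longrightarrow> lin_ext scale f b = 0"
  shows "lin_ext scale f x = 0"
  using assms(1)
  by (induction rule: free_space.span_induct_alt) (simp_all add: lin_ext_add lin_ext_fscale assms(2))

lemma
  fixes \<phi> :: "'b \<Rightarrow> 'a"
  shows lform_add: "lform scale \<phi> \<Longrightarrow> \<phi> (a + b) = \<phi> a + \<phi> b"
  and lform_scale: "lform scale \<phi> \<Longrightarrow> \<phi> (scale c a) = c * \<phi> a"
  by (simp_all add: lform_def)

lemma lform_0:
  fixes \<phi> :: "'b \<Rightarrow> 'a"
  shows "lform scale \<phi> \<Longrightarrow> \<phi> 0 = 0"
  using lform_scale[of \<phi> 0 0] by simp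

lemma lform_lin_ext:
  fixes \<phi> :: "'b \<Rightarrow> 'a"
  assumes "lform scale \<phi>" shows "\<phi> (lin_ext scale f x) = lin_ext (*) (\<lambda>p. \<phi> (f p)) x"
proof -
  have "finite A \<Longrightarrow> \<phi> (\<Sum>p\<in>A. g p) = (\<Sum>p\<in>A. \<phi> (g p))" for g :: "'c \<Rightarrow> 'b" and A
    by (induction A rule: finite_induct) (simp_all add: lform_add[OF assms] lform_0[OF assms])
  then show ?thesis by (simp add: lin_ext_def lform_scale[OF assms])
qed

text \<open>A basis of \<open>W\<close> stays independent when \<open>x\<close> is adjoined, so a
  form may be prescribed as 1 at \<open>x\<close> and 0 on the basis.\<close>

lemma lform_separates_subspace:
  assumes "subspace W" "x \<notin> W"
  obtains \<phi> :: "'b \<Rightarrow> 'a" where "lform scale \<phi>" "\<And>w. w \<in> W \<Longrightarrow> \<phi> w = 0" "\<phi> x \<noteq> 0"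
proof -
  interpret K: vector_space "(*) :: 'a \<Rightarrow> 'a \<Rightarrow> 'a"
    by unfold_locales (auto simp: algebra_simps)
  interpret pair: vector_space_pair scale "(*) :: 'a \<Rightarrow> 'a \<Rightarrow> 'a" ..
  obtain B where B: "B \<subseteq> W" "independent B" "W \<subseteq> span B"
    using maximal_independent_subset by blast
  have "span B = W" using B assms(1) by (metis span_minimal subset_antisym)
  then have "x \<notin> span B" "x \<notin> B" using assms B by auto
  then have "independent (insert x B)" using B independent_insertI by blast
  then obtain g where g: "Vector_Spaces.linear scale (*) g"
      "\<And>v. v \<in> insert x B \<Longrightarrow> g v = (if v = x then 1 else 0)"
    using pair.linear_independent_extend[of "insert x B" "\<lambda>v. if v = x then 1 else 0"] by metis
  interpret g: Vector_Spaces.linear scale "(*)" g by (fact g(1))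
  have "g w = 0" if "w \<in> W" for w
  proof -
    have "w \<in> span B" using that B by auto
    then show ?thesis
      by (rule g.eq_0_on_span[rotated]) (use g(2) \<open>x \<notin> B\<close> in auto)
  qed
  moreover have "lform scale g" by (simp add: lform_def g.add g.scale)
  ultimately show thesis using that g(2) by auto
qed

lemma eq_by_lforms:
  assumes "\<And>\<phi> :: 'b \<Rightarrow> 'a. lform scale \<phi> \<Longrightarrow> \<phi> u = \<phi> v"
  shows "u = v"
proof (rule ccontr)
  assume "u \<noteq> v"
  then have "u - v \<notin> {0}" by simp
  then obtain \<phi> where \<phi>: "lform scale \<phi>" "\<phi> (u - v) \<noteq> 0"
    using lform_separates_subspace[OF subspace_single_0] by blast
  have "\<phi> u = \<phi> (u - v) + \<phi> v" using lform_add[OF \<phi>(1), of "u - v" v] by simp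
  then show False using assms[OF \<phi>(1)] \<phi>(2) by simp
qed

end

lemma vector_space_field: "vector_space ((*) :: 'k::field \<Rightarrow> 'k \<Rightarrow> 'k)"
  by unfold_locales (auto simp: algebra_simps)

text \<open>Linear forms on the free space are the extensions of functions on the generators; those
  killing \<open>B\<close> are the forms on the quotient, and they separate its points.\<close>

lemma coset_eq_iff_forms:
  fixes x y :: "'a \<Rightarrow>\<^sub>0 'k::field"
  shows "x +o free_space.span B = y +o free_space.span B \<longleftrightarrow>
    (\<forall>f. (\<forall>b\<in>B. lin_ext (*) f b = 0) \<longrightarrow> lin_ext (*) f x = lin_ext (*) f y)"
    (is "_ \<longleftrightarrow> ?R")
proof -
  interpret K: vector_space "(*) :: 'k \<Rightarrow> 'k \<Rightarrow> 'k" by (rule vector_space_field)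
  have "x - y \<in> free_space.span B \<longleftrightarrow> ?R"
  proof
    assume "x - y \<in> free_space.span B"
    then show ?R using K.lin_ext_span_eq_0[of "x - y" B] by (auto simp: K.lin_ext_diff)
  next
    assume R: ?R
    show "x - y \<in> free_space.span B"
    proof (rule ccontr)
      assume "x - y \<notin> free_space.span B"
      then obtain \<psi> where \<psi>: "lform fscale \<psi>"
          "\<And>w. w \<in> free_space.span B \<Longrightarrow> \<psi> w = 0" "\<psi> (x - y) \<noteq> 0"
        using free_space.lform_separates_subspace[OF free_space.subspace_span] by blast
      \<comment> \<open>A formal combination is the extension of its own generators, so
        \<open>\<psi>\<close> is recovered from its values on them, and these values serve as the
        test function.\<close>
      have id: "lin_ext fscale pure z = z" for z :: "'a \<Rightarrow>\<^sub>0 'k"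
        by (rule poly_mapping_eqI)
          (simp add: lin_ext_def lookup_sum lookup_single when_def in_keys_iff
            if_distrib[of "(*) _"] cong: if_cong)
      have ext: "lin_ext (*) (\<lambda>p. \<psi> (pure p)) z = \<psi> z" for z
        using free_space.lform_lin_ext[OF \<psi>(1), of pure z] by (simp add: id)
      have "\<psi> x = \<psi> y"
        using R[rule_format, of "\<lambda>p. \<psi> (pure p)"] \<psi>(2) by (simp add: ext free_space.span_base)
      moreover have "\<psi> (x - y) + \<psi> y = \<psi> x"
        using free_space.lform_add[OF \<psi>(1), of "x - y" y] by simp
      ultimately show False using \<psi>(3) by simp
    qed
  qed
  then show ?thesis by (simp add: elt_set_plus_eq_iff_diff free_space.subspace_span)
qed

global_interpretation K: vector_space "(*) :: 'k::field \<Rightarrow> 'k \<Rightarrow> 'k"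
  by (rule vector_space_field)

section \<open>Evaluation of bilinear and trilinear forms\<close>

definition bform :: "('k::field \<Rightarrow> 'v::ab_group_add \<Rightarrow> 'v) \<Rightarrow> ('v \<Rightarrow> 'v \<Rightarrow> 'k) \<Rightarrow> bool"
  where "bform s f \<longleftrightarrow> (\<forall>b. lform s (\<lambda>a. f a b)) \<and> (\<forall>a. lform s (\<lambda>b. f a b))"

definition tform :: "('k::field \<Rightarrow> 'v::ab_group_add \<Rightarrow> 'v) \<Rightarrow> ('v \<Rightarrow> 'v \<Rightarrow> 'v \<Rightarrow> 'k) \<Rightarrow> bool"
  where "tform s f \<longleftrightarrow> (\<forall>b c. lform s (\<lambda>a. f a b c)) \<and> (\<forall>a c. lform s (\<lambda>b. f a b c))
    \<and> (\<forall>a b. lform s (\<lambda>c. f a b c))"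

definition ev :: "('a \<Rightarrow> 'b \<Rightarrow> 'k) \<Rightarrow> ('a \<times> 'b \<Rightarrow>\<^sub>0 'k::field) \<Rightarrow> 'k"
  where "ev f x = lin_ext (*) (\<lambda>(a, b). f a b) x"

definition ev3 :: "('a \<Rightarrow> 'b \<Rightarrow> 'c \<Rightarrow> 'k) \<Rightarrow> ('a \<times> 'b \<times> 'c \<Rightarrow>\<^sub>0 'k::field) \<Rightarrow> 'k"
  where "ev3 f x = lin_ext (*) (\<lambda>(a, b, c). f a b c) x"

lemma bformI: "(\<And>b. lform s (\<lambda>a. f a b)) \<Longrightarrow> (\<And>a. lform s (\<lambda>b. f a b)) \<Longrightarrow> bform s f"
  by (simp add: bform_def)

lemma bform1: "bform s f \<Longrightarrow> lform s (\<lambda>a. f a b)"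
  and bform2: "bform s f \<Longrightarrow> lform s (\<lambda>b. f a b)"
  by (simp_all add: bform_def)

lemma tformI: "(\<And>b c. lform s (\<lambda>a. f a b c)) \<Longrightarrow> (\<And>a c. lform s (\<lambda>b. f a b c)) \<Longrightarrow>
    (\<And>a b. lform s (\<lambda>c. f a b c)) \<Longrightarrow> tform s f"
  by (simp add: tform_def)

lemma tform1: "tform s f \<Longrightarrow> lform s (\<lambda>a. f a b c)"
  and tform2: "tform s f \<Longrightarrow> lform s (\<lambda>b. f a b c)"
  and tform3: "tform s f \<Longrightarrow> lform s (\<lambda>c. f a b c)"
  by (simp_all add: tform_def)

lemma ev_pure [simp]: "ev f (pure (a, b)) = f a b"
  by (simp add: ev_def)

lemma ev_add: "ev f (x + y) = ev f x + ev f y"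
  by (simp add: ev_def K.lin_ext_add)

lemma ev_fscale: "ev f (fscale c x) = c * ev f x"
  by (simp add: ev_def K.lin_ext_fscale)

lemma ev_add_fun: "ev (\<lambda>a b. f a b + g a b) x = ev f x + ev g x"
  by (simp add: ev_def case_prod_unfold K.lin_ext_add_fun)

lemma ev_mult_left: "ev (\<lambda>a b. c * f a b) x = c * ev f x"
  by (simp add: ev_def case_prod_unfold K.lin_ext_scale_fun)

lemma ev_mult_right: "ev (\<lambda>a b. f a b * c) x = ev f x * c"
  using ev_mult_left[of c f x] by (simp add: mult.commute)

lemma ev_swap: "ev (\<lambda>a b. ev (\<lambda>c d. f a b c d) y) x = ev (\<lambda>c d. ev (\<lambda>a b. f a b c d) x) y"
  unfolding ev_def lin_ext_def case_prod_unfold sum_distrib_left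
  by (subst sum.swap) (rule sum.cong[OF refl], rule sum.cong[OF refl], rule mult.left_commute)

lemma ev_lin_ext: "ev f (lin_ext fscale (\<lambda>(a, b). g a b) x) = ev (\<lambda>a b. ev f (g a b)) x"
  by (simp add: ev_def case_prod_unfold K.lin_ext_lin_ext)

lemma ev3_lin_ext: "ev3 f (lin_ext fscale (\<lambda>(a, b). g a b) x) = ev (\<lambda>a b. ev3 f (g a b)) x"
  by (simp add: ev_def ev3_def case_prod_unfold K.lin_ext_lin_ext)

lemma ev3_pure [simp]: "ev3 f (pure (a, b, c)) = f a b c"
  by (simp add: ev3_def)

lemma ev_formal_mult:
  fixes f :: "'a::times \<Rightarrow> 'b::times \<Rightarrow> 'k::field"
  shows "ev f (formal_mult mult2 x y) = ev (\<lambda>a b. ev (\<lambda>c d. f (a * c) (b * d)) y) x"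
proof -
  have "mult2 p q = (fst p * fst q, snd p * snd q)" for p q :: "'a \<times> 'b"
    by (cases p; cases q) simp
  then show ?thesis
    by (simp add: ev_def formal_mult_def K.lin_ext_lin_ext case_prod_unfold)
qed

lemma ev3_formal_mult:
  fixes f :: "'a::times \<Rightarrow> 'b::times \<Rightarrow> 'c::times \<Rightarrow> 'k::field"
  shows "ev3 f (formal_mult mult3 x y) = ev3 (\<lambda>a b c. ev3 (\<lambda>a' b' c'. f (a * a') (b * b') (c * c')) y) x"
proof -
  have "mult3 p q = (fst p * fst q, fst (snd p) * fst (snd q), snd (snd p) * snd (snd q))"
    for p q :: "'a \<times> 'b \<times> 'c"
    by (cases p; cases q) simp
  then show ?thesis
    by (simp add: ev3_def formal_mult_def K.lin_ext_lin_ext case_prod_unfold)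
qed

lemma coset_eq_iff_ev:
  "x +o free_space.span B = y +o free_space.span B \<longleftrightarrow>
    (\<forall>f. (\<forall>b\<in>B. ev f b = 0) \<longrightarrow> ev f x = ev f y)"
proof -
  have curry: "lin_ext (*) f = ev (\<lambda>a b. f (a, b))" for f :: "'a \<times> 'b \<Rightarrow> 'c"
    by (rule ext) (simp add: ev_def case_prod_unfold)
  show ?thesis
    unfolding coset_eq_iff_forms
  proof (intro iffI allI impI)
    fix f :: "'a \<Rightarrow> 'b \<Rightarrow> 'c"
    assume "\<forall>f. (\<forall>b\<in>B. lin_ext (*) f b = 0) \<longrightarrow> lin_ext (*) f x = lin_ext (*) f y"
      and "\<forall>b\<in>B. ev f b = 0"
    then show "ev f x = ev f y" by (simp add: ev_def)
  next
    fix f :: "'a \<times> 'b \<Rightarrow> 'c"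
    assume "\<forall>f. (\<forall>b\<in>B. ev f b = 0) \<longrightarrow> ev f x = ev f y"
      and "\<forall>b\<in>B. lin_ext (*) f b = 0"
    then show "lin_ext (*) f x = lin_ext (*) f y" by (simp add: curry)
  qed
qed

lemma coset_eq_iff_ev3:
  "x +o free_space.span B = y +o free_space.span B \<longleftrightarrow>
    (\<forall>f. (\<forall>b\<in>B. ev3 f b = 0) \<longrightarrow> ev3 f x = ev3 f y)"
proof -
  have curry: "lin_ext (*) f = ev3 (\<lambda>a b c. f (a, b, c))" for f :: "'a \<times> 'b \<times> 'c \<Rightarrow> 'd"
    by (rule ext) (simp add: ev3_def case_prod_unfold)
  show ?thesis
    unfolding coset_eq_iff_forms
  proof (intro iffI allI impI)
    fix f :: "'a \<Rightarrow> 'b \<Rightarrow> 'c \<Rightarrow> 'd"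
    assume "\<forall>f. (\<forall>b\<in>B. lin_ext (*) f b = 0) \<longrightarrow> lin_ext (*) f x = lin_ext (*) f y"
      and "\<forall>b\<in>B. ev3 f b = 0"
    then show "ev3 f x = ev3 f y" by (simp add: ev3_def)
  next
    fix f :: "'a \<times> 'b \<times> 'c \<Rightarrow> 'd"
    assume "\<forall>f. (\<forall>b\<in>B. ev3 f b = 0) \<longrightarrow> ev3 f x = ev3 f y"
      and "\<forall>b\<in>B. lin_ext (*) f b = 0"
    then show "lin_ext (*) f x = lin_ext (*) f y" by (simp add: curry)
  qed
qed

lemma ev_diff: "ev f (x - y) = ev f x - ev f y"
  by (simp add: ev_def K.lin_ext_diff)

lemma ev3_diff: "ev3 f (x - y) = ev3 f x - ev3 f y"
  by (simp add: ev3_def K.lin_ext_diff)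

lemma ev3_fscale: "ev3 f (fscale c x) = c * ev3 f x"
  by (simp add: ev3_def K.lin_ext_fscale)

text \<open>Matches the shape of the relator sets, so that a condition on all relators unfolds into
  identities in their parameters.\<close>

lemma ball_relators3:
  "(\<forall>x\<in>{r a b c | a b c. Q a b c}. P x) \<longleftrightarrow> (\<forall>a b c. Q a b c \<longrightarrow> P (r a b c))" (is "?L \<longleftrightarrow> ?R")
proof
  show ?R if ?L
  proof (intro allI impI)
    fix a b c assume "Q a b c"
    then have "r a b c \<in> {r a b c | a b c. Q a b c}" by blast
    then show "P (r a b c)" by (rule bspec[OF \<open>?L\<close>])
  qed
  show ?L if ?R
    using that by (intro ballI) (elim CollectE exE conjE, simp only:)
qed

lemma ball_relators4:
  "(\<forall>x\<in>{r a b c d | a b c d. Q a b c d}. P x) \<longleftrightarrow> (\<forall>a b c d. Q a b c d \<longrightarrow> P (r a b c d))"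
  (is "?L \<longleftrightarrow> ?R")
proof
  show ?R if ?L
  proof (intro allI impI)
    fix a b c d assume "Q a b c d"
    then have "r a b c d \<in> {r a b c d | a b c d. Q a b c d}" by blast
    then show "P (r a b c d)" by (rule bspec[OF \<open>?L\<close>])
  qed
  show ?L if ?R
    using that by (intro ballI) (elim CollectE exE conjE, simp only:)
qed

lemma diff_diff_eq_0_iff: "x - y - z = 0 \<longleftrightarrow> x = y + z" for x :: "'v::ab_group_add"
  by (simp add: diff_diff_eq)

text \<open>The four relator families are additivity and homogeneity in each argument: the universal
  property of the tensor product, on the level of forms.\<close>

lemma bilinear_relators_ev_iff:
  "(\<forall>b\<in>bilinear_relators s UNIV s UNIV. ev f b = 0) \<longleftrightarrow> bform s f"
  unfolding bilinear_relators_def bform_def lform_def ball_Un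
  unfolding ball_relators3 ball_relators4
  unfolding UNIV_I simp_thms ev_diff ev_fscale ev_pure diff_diff_eq_0_iff
  unfolding right_minus_eq
  by (intro iffI conjI allI; elim conjE; simp)

lemma trilinear_relators_ev3_iff:
  "(\<forall>b\<in>trilinear_relators s. ev3 f b = 0) \<longleftrightarrow> tform s f"
  unfolding trilinear_relators_def tform_def lform_def ball_Un
  unfolding ball_relators3 ball_relators4
  unfolding simp_thms ev3_diff ev3_fscale ev3_pure diff_diff_eq_0_iff
  unfolding right_minus_eq
  by (intro iffI conjI allI; elim conjE; simp only:)

lemma rel2_eq_iff: "x +o rel2 s = y +o rel2 s \<longleftrightarrow> (\<forall>f. bform s f \<longrightarrow> ev f x = ev f y)"
  unfolding rel2_def coset_eq_iff_ev bilinear_relators_ev_iff ..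

lemma rel3_eq_iff: "x +o rel3 s = y +o rel3 s \<longleftrightarrow> (\<forall>f. tform s f \<longrightarrow> ev3 f x = ev3 f y)"
  unfolding rel3_def coset_eq_iff_ev3 trilinear_relators_ev3_iff ..

definition lmap :: "('k::field \<Rightarrow> 'v::ab_group_add \<Rightarrow> 'v) \<Rightarrow> ('v \<Rightarrow> 'v) \<Rightarrow> bool"
  where "lmap s F \<longleftrightarrow> (\<forall>a b. F (a + b) = F a + F b) \<and> (\<forall>c a. F (s c a) = s c (F a))"

lemma lform_comp: "lform s \<phi> \<Longrightarrow> lmap s F \<Longrightarrow> lform s (\<lambda>a. \<phi> (F a))"
  by (simp add: lform_def lmap_def)

lemma lmap_comp: "lmap s G \<Longrightarrow> lmap s F \<Longrightarrow> lmap s (\<lambda>a. G (F a))"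
  by (simp add: lmap_def)

lemma lmap_id: "lmap s (\<lambda>a. a)"
  by (simp add: lmap_def)

lemma lform_mult_left: "lform s (\<lambda>a. c * \<phi> a)" if "lform s \<phi>"
  unfolding lform_def
proof (intro conjI allI)
  show "c * \<phi> (a + b) = c * \<phi> a + c * \<phi> b" for a b
    using that by (simp only: lform_def distrib_left)
  show "c * \<phi> (s d a) = d * (c * \<phi> a)" for d a
    using that by (simp only: lform_def mult.left_commute)
qed

lemma lform_mult_right: "lform s (\<lambda>a. \<phi> a * c)" if "lform s \<phi>"
  using lform_mult_left[OF that, of c] by (simp only: mult.commute)

lemma lform_ev: "(\<And>x y. lform s (\<lambda>a. f a x y)) \<Longrightarrow> lform s (\<lambda>a. ev (\<lambda>x y. f a x y) t)"
proof -
  assume "\<And>x y. lform s (\<lambda>a. f a x y)"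
  then have "f (a + b) = (\<lambda>x y. f a x y + f b x y)" "f (s c a) = (\<lambda>x y. c * f a x y)" for a b c
    by (intro ext; simp add: lform_def)+
  then show ?thesis by (simp add: lform_def ev_add_fun ev_mult_left)
qed

lemma (in vector_space) lform_expand: "lform scale (\<lambda>v. \<phi> v) \<Longrightarrow>
    \<phi> (lin_ext scale (\<lambda>(a, b). f a b) x) = ev (\<lambda>a b. \<phi> (f a b)) x"
  for \<phi> :: "'b \<Rightarrow> 'a"
  by (simp add: lform_lin_ext ev_def case_prod_unfold)

section \<open>Sweedler calculus in a weak bialgebra\<close>

sublocale weak_bialgebra \<subseteq> counital_maps scale \<Delta> \<epsilon> .

context weak_bialgebra
begin

lemma lmap_mult_right: "lmap scale F \<Longrightarrow> lmap scale (\<lambda>a. F a * b)"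
  and lmap_mult_left: "lmap scale F \<Longrightarrow> lmap scale (\<lambda>a. b * F a)"
  by (simp_all add: lmap_def distrib_left distrib_right scale_mult_left scale_mult_right)

lemma lform_counit: "lform scale \<epsilon>"
proof -
  interpret e: Vector_Spaces.linear scale "(*)" \<epsilon> by (rule counit_linear)
  show ?thesis by (simp add: lform_def e.add e.scale)
qed

definition sw :: "'h \<Rightarrow> ('h \<Rightarrow> 'h \<Rightarrow> 'k) \<Rightarrow> 'k"
  where "sw h f = ev f (rep (\<Delta> h))"

lemma rep_comult: "rep (\<Delta> h) +o rel2 scale = \<Delta> h"
proof -
  obtain x where "\<Delta> h = x +o rel2 scale" using comult_tensor[of h] by blast
  then show ?thesis by (simp add: rep_coset rel2_def free_space.subspace_span)
qed

text \<open>A bilinear form is constant on cosets of \<open>rel2\<close>; hence each axiom that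
  exhibits a representative of a value of \<Delta> becomes a rule for \<open>sw\<close>.\<close>

lemma sw_unique: "\<Delta> h = x +o rel2 scale \<Longrightarrow> bform scale f \<Longrightarrow> sw h f = ev f x"
  unfolding sw_def using rep_comult[of h] rel2_eq_iff[of "rep (\<Delta> h)" scale x] by simp

lemma sw_add: "bform scale f \<Longrightarrow> sw (g + h) f = sw g f + sw h f"
  by (subst sw_unique[OF comult_add]) (simp_all add: ev_add sw_def)

lemma sw_scale: "bform scale f \<Longrightarrow> sw (scale c h) f = c * sw h f"
  by (subst sw_unique[OF comult_scale]) (simp_all add: ev_fscale sw_def)

lemma sw_mult: "bform scale f \<Longrightarrow> sw (g * h) f = sw g (\<lambda>a b. sw h (\<lambda>c d. f (a * c) (b * d)))"
  by (subst sw_unique[OF comult_mult]) (simp_all add: ev_formal_mult sw_def)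

lemma sw_swap: "sw g (\<lambda>a b. sw h (\<lambda>c d. f a b c d)) = sw h (\<lambda>c d. sw g (\<lambda>a b. f a b c d))"
  unfolding sw_def by (rule ev_swap)

lemma sw_mult_left: "sw h (\<lambda>a b. c * f a b) = c * sw h f"
  unfolding sw_def by (rule ev_mult_left)

lemma sw_mult_right: "sw h (\<lambda>a b. f a b * c) = sw h f * c"
  unfolding sw_def by (rule ev_mult_right)

lemma lform_sw: "bform scale f \<Longrightarrow> lform scale (\<lambda>a. sw a f)"
  by (simp add: lform_def sw_add sw_scale)

lemma lform_sw_arg: "bform scale f \<Longrightarrow> lmap scale F \<Longrightarrow> lform scale (\<lambda>a. sw (F a) f)"
  by (rule lform_comp[OF lform_sw])

lemma lform_sw_fun: "(\<And>x y. lform scale (\<lambda>a. f a x y)) \<Longrightarrow> lform scale (\<lambda>a. sw h (\<lambda>x y. f a x y))"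
  unfolding sw_def by (rule lform_ev)

lemma lform_expand_sw: "lform scale \<phi> \<Longrightarrow>
    \<phi> (lin_ext scale (\<lambda>(a, b). f a b) (rep (\<Delta> h))) = sw h (\<lambda>a b. \<phi> (f a b))"
  unfolding sw_def by (rule lform_expand)

lemma lform_es: "lform scale \<phi> \<Longrightarrow> \<phi> (\<epsilon>s h) = sw 1 (\<lambda>a b. \<epsilon> (h * b) * \<phi> a)"
  and lform_et: "lform scale \<phi> \<Longrightarrow> \<phi> (\<epsilon>t h) = sw 1 (\<lambda>a b. \<epsilon> (a * h) * \<phi> b)"
  and lform_es': "lform scale \<phi> \<Longrightarrow> \<phi> (\<epsilon>s' h) = sw 1 (\<lambda>a b. \<epsilon> (b * h) * \<phi> a)"
  by (simp_all add: \<epsilon>s_def \<epsilon>t_def \<epsilon>s'_def lform_expand_sw lform_scale)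

lemma lmap_by_lforms:
  assumes "\<And>\<phi>. lform scale \<phi> \<Longrightarrow> lform scale (\<lambda>a. \<phi> (F a))"
  shows "lmap scale F"
  unfolding lmap_def
proof (intro conjI allI)
  show "F (a + b) = F a + F b" for a b
    by (rule eq_by_lforms) (use assms in \<open>simp add: lform_def\<close>)
  show "F (scale c a) = scale c (F a)" for c a
    by (rule eq_by_lforms) (use assms in \<open>simp add: lform_def\<close>)
qed

text \<open>With an unknown form, \<open>lform_comp\<close> would match any goal, so it enters only
  for fixed forms: the counit here, and local forms in the lists \<open>L\<close> of the proofs.
  Backward chaining then proves the linearity side conditions.\<close>

lemmas lform_intros = lform_mult_left lform_mult_right lform_sw_fun lform_sw_arg lform_ev
  bformI tformI lform_comp[OF lform_counit] lmap_id lmap_mult_right lmap_mult_left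

lemma lmap_es0: "lmap scale \<epsilon>s" and lmap_et0: "lmap scale \<epsilon>t" and lmap_es'0: "lmap scale \<epsilon>s'"
  by (rule lmap_by_lforms, simp add: lform_es lform_et lform_es', (intro lform_intros))+

lemmas lmap_es = lmap_comp[OF lmap_es0] and lmap_et = lmap_comp[OF lmap_et0]
  and lmap_es' = lmap_comp[OF lmap_es'0]

lemmas lin_intros = lform_intros lmap_es lmap_et lmap_es'

lemma sw_coassoc:
  assumes "tform scale f"
  shows "sw h (\<lambda>a b. sw a (\<lambda>c d. f c d b)) = sw h (\<lambda>a b. sw b (\<lambda>c d. f a c d))"
proof -
  have "ev3 f (iter_left \<Delta> h) = ev3 f (iter_right \<Delta> h)"
    using coassoc[of h] assms by (simp add: rel3_eq_iff)
  then show ?thesis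
    by (simp add: iter_left_def iter_right_def ev3_lin_ext sw_def)
qed

lemma sw_counit_left: "lform scale \<phi> \<Longrightarrow> sw h (\<lambda>a b. \<epsilon> a * \<phi> b) = \<phi> h"
  using lform_expand_sw[of \<phi> "\<lambda>a b. scale (\<epsilon> a) b" h] by (simp add: lform_scale counit_left)

lemma sw_counit_right: "lform scale \<phi> \<Longrightarrow> sw h (\<lambda>a b. \<phi> a * \<epsilon> b) = \<phi> h"
  using lform_expand_sw[of \<phi> "\<lambda>a b. scale (\<epsilon> b) a" h]
  by (simp add: lform_scale counit_right mult.commute)

lemma counit_sw1: "\<epsilon> (f * g * h) = sw g (\<lambda>a b. \<epsilon> (f * a) * \<epsilon> (b * h))"
  by (simp add: counit_mult1 sw_def ev_def)

lemma counit_sw2: "\<epsilon> (f * g * h) = sw g (\<lambda>a b. \<epsilon> (f * b) * \<epsilon> (a * h))"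
  by (simp add: counit_mult2 sw_def ev_def)

text \<open>Coassociativity converts the left iterate of the unit axiom to the right one. In this
  rule and the next, the middle leg of the iterated \<Delta>(1) is a product of legs of two copies
  of \<Delta>(1), in either order.\<close>

lemma sw_one1:
  assumes "tform scale f"
  shows "sw 1 (\<lambda>a b. sw b (\<lambda>c d. f a c d)) = sw 1 (\<lambda>a b. sw 1 (\<lambda>c d. f a (b * c) d))"
  using comult_one1 assms unfolding sw_coassoc[OF assms, symmetric]
  by (simp add: rel3_eq_iff iter_left_def ev3_lin_ext sw_def ev3_formal_mult)

lemma sw_one2:
  assumes "tform scale f"
  shows "sw 1 (\<lambda>a b. sw b (\<lambda>c d. f a c d)) = sw 1 (\<lambda>a b. sw 1 (\<lambda>c d. f a (c * b) d))"
proof -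
  have "sw 1 (\<lambda>a b. sw b (\<lambda>c d. f a c d)) = sw 1 (\<lambda>c d. sw 1 (\<lambda>a b. f a (c * b) d))"
    using comult_one2 assms unfolding sw_coassoc[OF assms, symmetric]
    by (simp add: rel3_eq_iff iter_left_def ev3_lin_ext sw_def ev3_formal_mult)
  then show ?thesis by (subst sw_swap)
qed

section \<open>Counital maps\<close>

text \<open>Middle factor 1 in the weak counit axioms yields the two sums over \<Delta>(1) by which
  \<epsilon> absorbs counital maps.\<close>

lemma counit_mult_one1: "sw 1 (\<lambda>a b. \<epsilon> (f * a) * \<epsilon> (b * h)) = \<epsilon> (f * h)"
  using counit_sw1[of f 1 h] by simp

lemma counit_mult_one2: "sw 1 (\<lambda>a b. \<epsilon> (a * h) * \<epsilon> (f * b)) = \<epsilon> (f * h)"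
  using counit_sw2[of f 1 h] by (simp add: mult.commute[of "\<epsilon> (f * _)"])

lemma counit_mult_et: "\<epsilon> (f * \<epsilon>t h) = \<epsilon> (f * h)"
proof -
  have "lform scale (\<lambda>u. \<epsilon> (f * u))" by (intro lin_intros)
  from lform_et[OF this] show ?thesis by (simp add: counit_mult_one2)
qed

lemma counit_es_mult: "\<epsilon> (\<epsilon>s f * h) = \<epsilon> (f * h)"
proof -
  have "lform scale (\<lambda>u. \<epsilon> (u * h))" by (intro lin_intros)
  from lform_es[OF this, of f] counit_mult_one2[of h f] show ?thesis
    by (simp add: mult.commute[of "\<epsilon> (f * _)"])
qed

lemma counit_mult_es': "\<epsilon> (f * \<epsilon>s' h) = \<epsilon> (f * h)"
proof -
  have "lform scale (\<lambda>u. \<epsilon> (f * u))" by (intro lin_intros)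
  from lform_es'[OF this, of h] counit_mult_one1[of f h] show ?thesis
    by (simp add: mult.commute[of "\<epsilon> (_ * h)"])
qed

lemma et_mult_et: "\<epsilon>t (g * \<epsilon>t h) = \<epsilon>t (g * h)"
  by (simp only: \<epsilon>t_def[of "g * _"] mult.assoc[symmetric] counit_mult_et)

lemma et_et [simp]: "\<epsilon>t (\<epsilon>t h) = \<epsilon>t h"
  using et_mult_et[of 1 h] by simp

lemma et_es' [simp]: "\<epsilon>t (\<epsilon>s' h) = \<epsilon>t h"
  by (simp only: \<epsilon>t_def counit_mult_es')

lemma es'_et [simp]: "\<epsilon>s' (\<epsilon>t h) = \<epsilon>s' h"
  by (simp only: \<epsilon>s'_def counit_mult_et)

lemma es_mult_es: "\<epsilon>s (\<epsilon>s g * h) = \<epsilon>s (g * h)"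
  by (simp only: \<epsilon>s_def[of "_ * h"] mult.assoc counit_es_mult)

lemma es_es [simp]: "\<epsilon>s (\<epsilon>s h) = \<epsilon>s h"
  using es_mult_es[of h 1] by simp

text \<open>By \<open>sw_one2\<close> the two copies of \<Delta>(1) in 1_1 \<epsilon>(1'_1 1_2)
  \<epsilon>(1'_2 h) merge into one iterate, whose middle leg the counit removes. With
  \<open>es'_es\<close>, which uses the other order, \<open>\<epsilon>s\<close> and
  \<open>\<epsilon>s'\<close> have the same image.\<close>

lemma es_es' [simp]: "\<epsilon>s (\<epsilon>s' h) = \<epsilon>s' h"
proof (rule eq_by_lforms)
  fix \<phi> :: "'h \<Rightarrow> 'k" assume \<phi>: "lform scale \<phi>"
  note L = lin_intros lform_comp[OF \<phi>]
  have A: "\<epsilon> (\<epsilon>s' h * b) = sw 1 (\<lambda>c d. \<epsilon> (d * h) * \<epsilon> (c * b))" for b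
    by (rule lform_es') (intro L)
  have "\<phi> (\<epsilon>s (\<epsilon>s' h)) = sw 1 (\<lambda>a b. sw 1 (\<lambda>c d. \<epsilon> (d * h) * \<epsilon> (c * b) * \<phi> a))"
    by (simp only: lform_es[OF \<phi>] A sw_mult_right)
  also have "\<dots> = sw 1 (\<lambda>a b. sw b (\<lambda>c d. \<epsilon> (d * h) * \<epsilon> c * \<phi> a))"
    by (rule sw_one2[of "\<lambda>a u d. \<epsilon> (d * h) * \<epsilon> u * \<phi> a", symmetric]) (intro L)
  also have "\<dots> = sw 1 (\<lambda>a b. \<epsilon> (b * h) * \<phi> a)"
  proof -
    have "sw b (\<lambda>c d. \<epsilon> c * \<epsilon> (d * h)) = \<epsilon> (b * h)" for b
      by (rule sw_counit_left) (intro L)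
    then show ?thesis by (simp only: sw_mult_right mult.commute[of "\<epsilon> (_ * h)" "\<epsilon> _"])
  qed
  finally show "\<phi> (\<epsilon>s (\<epsilon>s' h)) = \<phi> (\<epsilon>s' h)" by (simp only: lform_es'[OF \<phi>])
qed

lemma es'_es [simp]: "\<epsilon>s' (\<epsilon>s h) = \<epsilon>s h"
proof (rule eq_by_lforms)
  fix \<phi> :: "'h \<Rightarrow> 'k" assume \<phi>: "lform scale \<phi>"
  note L = lin_intros lform_comp[OF \<phi>]
  have A: "\<epsilon> (b * \<epsilon>s h) = sw 1 (\<lambda>c d. \<epsilon> (h * d) * \<epsilon> (b * c))" for b
    by (rule lform_es) (intro L)
  have "\<phi> (\<epsilon>s' (\<epsilon>s h)) = sw 1 (\<lambda>a b. sw 1 (\<lambda>c d. \<epsilon> (h * d) * \<epsilon> (b * c) * \<phi> a))"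
    by (simp only: lform_es'[OF \<phi>] A sw_mult_right)
  also have "\<dots> = sw 1 (\<lambda>a b. sw b (\<lambda>c d. \<epsilon> (h * d) * \<epsilon> c * \<phi> a))"
    by (rule sw_one1[of "\<lambda>a u d. \<epsilon> (h * d) * \<epsilon> u * \<phi> a", symmetric]) (intro L)
  also have "\<dots> = sw 1 (\<lambda>a b. \<epsilon> (h * b) * \<phi> a)"
  proof -
    have "sw b (\<lambda>c d. \<epsilon> c * \<epsilon> (h * d)) = \<epsilon> (h * b)" for b
      by (rule sw_counit_left) (intro L)
    then show ?thesis by (simp only: sw_mult_right mult.commute[of "\<epsilon> (h * _)" "\<epsilon> _"])
  qed
  finally show "\<phi> (\<epsilon>s' (\<epsilon>s h)) = \<phi> (\<epsilon>s h)" by (simp only: lform_es[OF \<phi>])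
qed

section \<open>Comultiplication of products with source and target elements\<close>

lemma sw_es:
  assumes f: "bform scale f"
  shows sw_es_left: "sw (\<epsilon>s h) f = sw 1 (\<lambda>a b. f a (\<epsilon>s h * b))"
    and sw_es_right: "sw (\<epsilon>s h) f = sw 1 (\<lambda>a b. f a (b * \<epsilon>s h))"
proof -
  note L = lin_intros f lform_comp[OF bform1[OF f]] lform_comp[OF bform2[OF f]]
  \<comment> \<open>Coassociativity shifts \<Delta>(1_1) \<otimes> 1_2 to 1_1 \<otimes>
    \<Delta>(1_2), so the counit acts on the third leg; each order of the weak unit axiom splits
    that leg off and leaves \<open>\<epsilon>s h\<close> on one side of the second.\<close>
  have T: "tform scale (\<lambda>a c d. \<epsilon> (h * d) * f a c)" by (intro L)
  have "sw (\<epsilon>s h) f = sw 1 (\<lambda>a b. sw a (\<lambda>c d. \<epsilon> (h * b) * f c d))"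
    by (simp only: sw_mult_left) (rule lform_es, intro L)
  also have "\<dots> = sw 1 (\<lambda>a b. sw b (\<lambda>c d. \<epsilon> (h * d) * f a c))"
    by (rule sw_coassoc[OF T])
  finally have *: "sw (\<epsilon>s h) f = sw 1 (\<lambda>a b. sw b (\<lambda>c d. \<epsilon> (h * d) * f a c))" .
  have "f a (b * \<epsilon>s h) = sw 1 (\<lambda>c d. \<epsilon> (h * d) * f a (b * c))" for a b
    by (rule lform_es) (intro L)
  then show "sw (\<epsilon>s h) f = sw 1 (\<lambda>a b. f a (b * \<epsilon>s h))"
    unfolding * sw_one1[OF T] by simp
  have "f a (\<epsilon>s h * b) = sw 1 (\<lambda>c d. \<epsilon> (h * d) * f a (c * b))" for a b
    by (rule lform_es) (intro L)
  then show "sw (\<epsilon>s h) f = sw 1 (\<lambda>a b. f a (\<epsilon>s h * b))"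
    unfolding * sw_one2[OF T] by simp
qed

text \<open>Mirror image of \<open>sw_es\<close>, with the counit on the first leg of the right
  iterate of \<Delta>(1).\<close>

lemma sw_et:
  assumes f: "bform scale f"
  shows sw_et_left: "sw (\<epsilon>t h) f = sw 1 (\<lambda>a b. f (\<epsilon>t h * a) b)"
    and sw_et_right: "sw (\<epsilon>t h) f = sw 1 (\<lambda>a b. f (a * \<epsilon>t h) b)"
proof -
  note L = lin_intros f lform_comp[OF bform1[OF f]] lform_comp[OF bform2[OF f]]
  have T: "tform scale (\<lambda>a c d. \<epsilon> (a * h) * f c d)" by (intro L)
  have *: "sw (\<epsilon>t h) f = sw 1 (\<lambda>a b. sw b (\<lambda>c d. \<epsilon> (a * h) * f c d))"
    by (simp only: sw_mult_left) (rule lform_et, intro L)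
  have left: "f (\<epsilon>t h * c) d = sw 1 (\<lambda>a b. \<epsilon> (a * h) * f (b * c) d)" for c d
    by (rule lform_et) (intro L)
  show "sw (\<epsilon>t h) f = sw 1 (\<lambda>a b. f (\<epsilon>t h * a) b)"
    unfolding * sw_one1[OF T] left by (rule sw_swap)
  have right: "f (c * \<epsilon>t h) d = sw 1 (\<lambda>a b. \<epsilon> (a * h) * f (c * b) d)" for c d
    by (rule lform_et) (intro L)
  show "sw (\<epsilon>t h) f = sw 1 (\<lambda>a b. f (a * \<epsilon>t h) b)"
    unfolding * sw_one2[OF T] right by (rule sw_swap)
qed

text \<open>By \<open>sw_es_right\<close> the legs 1_1 and 1_2 appear next to those of
  \<open>g\<close>, where \<Delta>(g) \<Delta>(1) = \<Delta>(g) absorbs them. The three companions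
  below vary the side and the subalgebra.\<close>

lemma sw_mult_es_right:
  assumes f: "bform scale f"
  shows "sw (g * \<epsilon>s h) f = sw g (\<lambda>a b. f a (b * \<epsilon>s h))"
proof -
  note L = lin_intros f lform_comp[OF bform1[OF f]] lform_comp[OF bform2[OF f]]
  have "sw (g * \<epsilon>s h) f = sw g (\<lambda>a b. sw (\<epsilon>s h) (\<lambda>c d. f (a * c) (b * d)))"
    by (rule sw_mult[OF f])
  also have "\<dots> = sw g (\<lambda>a b. sw 1 (\<lambda>c d. f (a * c) (b * (d * \<epsilon>s h))))"
    by (subst sw_es_right) (intro L, rule refl)
  also have "\<dots> = sw (g * 1) (\<lambda>a b. f a (b * \<epsilon>s h))"
    by (subst sw_mult) (intro L, simp only: mult.assoc)
  finally show ?thesis by simp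
qed

lemma sw_mult_es_left:
  assumes f: "bform scale f"
  shows "sw (\<epsilon>s h * g) f = sw g (\<lambda>a b. f a (\<epsilon>s h * b))"
proof -
  note L = lin_intros f lform_comp[OF bform1[OF f]] lform_comp[OF bform2[OF f]]
  have "sw (\<epsilon>s h * g) f = sw (\<epsilon>s h) (\<lambda>a b. sw g (\<lambda>c d. f (a * c) (b * d)))"
    by (rule sw_mult[OF f])
  also have "\<dots> = sw 1 (\<lambda>a b. sw g (\<lambda>c d. f (a * c) (\<epsilon>s h * b * d)))"
    by (subst sw_es_left) (intro L, rule refl)
  also have "\<dots> = sw (1 * g) (\<lambda>a b. f a (\<epsilon>s h * b))"
    by (subst sw_mult) (intro L, simp only: mult.assoc)
  finally show ?thesis by simp
qed

lemma sw_mult_et_right: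
  assumes f: "bform scale f"
  shows "sw (g * \<epsilon>t h) f = sw g (\<lambda>a b. f (a * \<epsilon>t h) b)"
proof -
  note L = lin_intros f lform_comp[OF bform1[OF f]] lform_comp[OF bform2[OF f]]
  have "sw (g * \<epsilon>t h) f = sw g (\<lambda>a b. sw (\<epsilon>t h) (\<lambda>c d. f (a * c) (b * d)))"
    by (rule sw_mult[OF f])
  also have "\<dots> = sw g (\<lambda>a b. sw 1 (\<lambda>c d. f (a * (c * \<epsilon>t h)) (b * d)))"
    by (subst sw_et_right) (intro L, rule refl)
  also have "\<dots> = sw (g * 1) (\<lambda>a b. f (a * \<epsilon>t h) b)"
    by (subst sw_mult) (intro L, simp only: mult.assoc)
  finally show ?thesis by simp
qed

lemma sw_mult_et_left:
  assumes f: "bform scale f"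
  shows "sw (\<epsilon>t h * g) f = sw g (\<lambda>a b. f (\<epsilon>t h * a) b)"
proof -
  note L = lin_intros f lform_comp[OF bform1[OF f]] lform_comp[OF bform2[OF f]]
  have "sw (\<epsilon>t h * g) f = sw (\<epsilon>t h) (\<lambda>a b. sw g (\<lambda>c d. f (a * c) (b * d)))"
    by (rule sw_mult[OF f])
  also have "\<dots> = sw 1 (\<lambda>a b. sw g (\<lambda>c d. f (\<epsilon>t h * a * c) (b * d)))"
    by (subst sw_et_left) (intro L, rule refl)
  also have "\<dots> = sw (1 * g) (\<lambda>a b. f (\<epsilon>t h * a) b)"
    by (subst sw_mult) (intro L, simp only: mult.assoc)
  finally show ?thesis by simp
qed

text \<open>Expanding both counital maps gives \<epsilon>(1_1 h) \<epsilon>(g 1'_2) times 1_2 1'_1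
  or 1'_1 1_2, the two forms of the middle leg in the weak unit axiom.\<close>

lemma et_es_commute: "\<epsilon>t h * \<epsilon>s g = \<epsilon>s g * \<epsilon>t h"
proof (rule eq_by_lforms)
  fix \<phi> :: "'h \<Rightarrow> 'k" assume \<phi>: "lform scale \<phi>"
  note L = lin_intros lform_comp[OF \<phi>]
  have T: "tform scale (\<lambda>a u d. \<epsilon> (a * h) * (\<epsilon> (g * d) * \<phi> u))" by (intro L)
  have es: "\<phi> (b * \<epsilon>s g) = sw 1 (\<lambda>c d. \<epsilon> (g * d) * \<phi> (b * c))"
    "\<phi> (\<epsilon>s g * b) = sw 1 (\<lambda>c d. \<epsilon> (g * d) * \<phi> (c * b))" for b
    by (rule lform_es, intro L)+
  have "\<phi> (\<epsilon>t h * \<epsilon>s g) = sw 1 (\<lambda>a b. \<epsilon> (a * h) * \<phi> (b * \<epsilon>s g))"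
    by (rule lform_et) (intro L)
  also have "\<dots> = sw 1 (\<lambda>a b. \<epsilon> (a * h) * \<phi> (\<epsilon>s g * b))"
    using sw_one1[OF T] sw_one2[OF T] by (simp only: es sw_mult_left)
  also have "\<dots> = \<phi> (\<epsilon>s g * \<epsilon>t h)"
    by (rule lform_et[symmetric]) (intro L)
  finally show "\<phi> (\<epsilon>t h * \<epsilon>s g) = \<phi> (\<epsilon>s g * \<epsilon>t h)" .
qed

section \<open>The counital subalgebras and the anti-isomorphism between them\<close>

lemma et_one [simp]: "\<epsilon>t 1 = 1"
  by (rule eq_by_lforms) (simp add: lform_et sw_counit_left)

lemma es'_one [simp]: "\<epsilon>s' 1 = 1"
  by (rule eq_by_lforms) (simp add: lform_es' mult.commute[of "\<epsilon> _"] sw_counit_right)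

text \<open>The counit on the first leg of \<Delta> of the product gives the product back, while the
  rules for target elements rewrite that leg until the sum defining \<open>\<epsilon>t\<close>
  appears.\<close>

lemma et_closed: "\<epsilon>t (\<epsilon>t y * \<epsilon>t z) = \<epsilon>t y * \<epsilon>t z"
proof (rule eq_by_lforms)
  fix \<phi> :: "'h \<Rightarrow> 'k" assume \<phi>: "lform scale \<phi>"
  note L = lin_intros lform_comp[OF \<phi>]
  have "\<phi> (\<epsilon>t y * \<epsilon>t z) = sw (\<epsilon>t y * \<epsilon>t z) (\<lambda>a b. \<epsilon> a * \<phi> b)"
    by (rule sw_counit_left[OF \<phi>, symmetric])
  also have "\<dots> = sw (\<epsilon>t y) (\<lambda>a b. \<epsilon> (a * \<epsilon>t z) * \<phi> b)"
    by (rule sw_mult_et_right) (intro L)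
  also have "\<dots> = sw 1 (\<lambda>a b. \<epsilon> (a * \<epsilon>t y * \<epsilon>t z) * \<phi> b)"
    by (rule sw_et_right) (intro L)
  finally show "\<phi> (\<epsilon>t (\<epsilon>t y * \<epsilon>t z)) = \<phi> (\<epsilon>t y * \<epsilon>t z)"
    by (simp only: lform_et[OF \<phi>, of "_ * _"] mult.assoc)
qed

lemma es_closed: "\<epsilon>s (\<epsilon>s y * \<epsilon>s z) = \<epsilon>s y * \<epsilon>s z"
proof (rule eq_by_lforms)
  fix \<phi> :: "'h \<Rightarrow> 'k" assume \<phi>: "lform scale \<phi>"
  note L = lin_intros lform_comp[OF \<phi>]
  have "\<phi> (\<epsilon>s y * \<epsilon>s z) = sw (\<epsilon>s y * \<epsilon>s z) (\<lambda>a b. \<phi> a * \<epsilon> b)"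
    by (rule sw_counit_right[OF \<phi>, symmetric])
  also have "\<dots> = sw (\<epsilon>s z) (\<lambda>a b. \<phi> a * \<epsilon> (\<epsilon>s y * b))"
    by (rule sw_mult_es_left) (intro L)
  also have "\<dots> = sw 1 (\<lambda>a b. \<phi> a * \<epsilon> (\<epsilon>s y * (\<epsilon>s z * b)))"
    by (rule sw_es_left) (intro L)
  finally show "\<phi> (\<epsilon>s (\<epsilon>s y * \<epsilon>s z)) = \<phi> (\<epsilon>s y * \<epsilon>s z)"
    by (simp only: lform_es[OF \<phi>, of "_ * _"] mult.assoc mult.commute[of "\<phi> _"])
qed

lemma et_et_mult: "\<epsilon>t (\<epsilon>t y * h) = \<epsilon>t y * \<epsilon>t h"
  using et_mult_et[of "\<epsilon>t y" h] by (simp add: et_closed)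

lemma es_mult_es_right: "\<epsilon>s (g * \<epsilon>s x) = \<epsilon>s g * \<epsilon>s x"
  using es_mult_es[of g "\<epsilon>s x"] by (simp add: es_closed)

lemma et_es'_commute: "\<epsilon>t h * \<epsilon>s' g = \<epsilon>s' g * \<epsilon>t h"
  using et_es_commute[of h "\<epsilon>s' g"] by simp

text \<open>Under \<open>\<epsilon>t\<close>, the factor \<open>m\<close> may be replaced by
  \<open>\<epsilon>t m\<close>, which commutes with the source element and can then be pulled out on
  the left. This reversal matches \<open>\<epsilon>s'\<close> with the opposite of the base.\<close>

lemma et_es'_mult: "\<epsilon>t (\<epsilon>s' r * m) = \<epsilon>t m * \<epsilon>t r"
proof -
  have "\<epsilon>t (\<epsilon>s' r * m) = \<epsilon>t (\<epsilon>t m * \<epsilon>s' r)"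
    by (simp add: et_mult_et[of "\<epsilon>s' r" m, symmetric] et_es'_commute)
  then show ?thesis by (simp add: et_et_mult)
qed

text \<open>By \<open>et_es'_mult\<close> the product on the left is the image under
  \<open>\<epsilon>t\<close> of \<open>\<epsilon>s' r * \<epsilon>s' s\<close>, an element of H_s,
  and there \<open>\<epsilon>s'\<close> undoes \<open>\<epsilon>t\<close>.\<close>

lemma es'_antimult: "\<epsilon>s' (\<epsilon>t s * \<epsilon>t r) = \<epsilon>s' r * \<epsilon>s' s"
proof -
  have "\<epsilon>s' (\<epsilon>t s * \<epsilon>t r) = \<epsilon>s' (\<epsilon>t (\<epsilon>s' r * \<epsilon>s' s))"
    by (simp add: et_es'_mult)
  also have "\<dots> = \<epsilon>s' r * \<epsilon>s' s"
    using es_closed[of "\<epsilon>s' r" "\<epsilon>s' s"] es'_es[of "\<epsilon>s' r * \<epsilon>s' s"] by simp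
  finally show ?thesis .
qed

section \<open>Target legs, balancing and counit identities\<close>

lemma sw_et_second:
  assumes f: "bform scale f"
  shows "sw h (\<lambda>a b. f a (\<epsilon>t b)) = sw 1 (\<lambda>a b. f (a * h) b)"
proof -
  note L = lin_intros f lform_comp[OF bform1[OF f]] lform_comp[OF bform2[OF f]]
  \<comment> \<open>The counit creates a spare leg: the sum becomes 1_1 h_1 \<epsilon>(1_2 h_2)
    \<otimes> 1_3. After \<open>sw_one2\<close> splits the iterated \<Delta>(1), one copy merges
    with \<Delta>(h) and the other forms \<epsilon>t(h_2).\<close>
  have "f (a * h) b = sw (a * h) (\<lambda>p q. f p b * \<epsilon> q)" for a b
    by (rule sw_counit_right[symmetric]) (intro L)
  also have "\<dots> a b = sw a (\<lambda>c d. sw h (\<lambda>p q. f (c * p) b * \<epsilon> (d * q)))" for a b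
    by (rule sw_mult) (intro L)
  finally have "sw 1 (\<lambda>a b. f (a * h) b)
      = sw 1 (\<lambda>a b. sw a (\<lambda>c d. sw h (\<lambda>p q. f (c * p) b * \<epsilon> (d * q))))" by simp
  also have "\<dots> = sw 1 (\<lambda>a b. sw b (\<lambda>c d. sw h (\<lambda>p q. f (a * p) d * \<epsilon> (c * q))))"
    by (rule sw_coassoc) (intro L)
  also have "\<dots> = sw 1 (\<lambda>a b. sw 1 (\<lambda>c d. sw h (\<lambda>p q. f (a * p) d * \<epsilon> (c * b * q))))"
    by (rule sw_one2) (intro L)
  also have "\<dots> = sw 1 (\<lambda>c d. sw 1 (\<lambda>a b. sw h (\<lambda>p q. f (a * p) d * \<epsilon> (c * (b * q)))))"
    by (subst sw_swap) (simp only: mult.assoc)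
  also have "\<dots> = sw 1 (\<lambda>c d. sw (1 * h) (\<lambda>p q. f p d * \<epsilon> (c * q)))"
    by (subst sw_mult[where g = 1 and h = h]) (intro L, rule refl)
  also have "\<dots> = sw h (\<lambda>p q. sw 1 (\<lambda>c d. \<epsilon> (c * q) * f p d))"
    by (subst sw_swap) (simp add: mult.commute[of "f _ _"])
  also have "\<dots> = sw h (\<lambda>a b. f a (\<epsilon>t b))"
    by (subst lform_et[symmetric]) (intro L, rule refl)
  finally show ?thesis by simp
qed

text \<open>The second leg of \<Delta>(1) lies in H_t, where right multiplication by
  \<open>\<epsilon>t r\<close> comes from left multiplication by \<open>\<epsilon>s' r\<close> under
  \<open>\<epsilon>t\<close>; the source element is then moved into \<Delta> and out to the first
  leg.\<close>

lemma sw_one_balanced: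
  assumes f: "bform scale f"
  shows "sw 1 (\<lambda>a b. f (a * \<epsilon>s' r) b) = sw 1 (\<lambda>a b. f a (b * \<epsilon>t r))"
proof -
  note L = lin_intros f lform_comp[OF bform1[OF f]] lform_comp[OF bform2[OF f]]
  have "sw 1 (\<lambda>a b. f a (b * \<epsilon>t r)) = sw 1 (\<lambda>a b. f a (\<epsilon>t b * \<epsilon>t r))"
    by (subst sw_et_second[of "\<lambda>a b. f a (b * \<epsilon>t r)" 1]) (intro L, simp)
  also have "\<dots> = sw 1 (\<lambda>a b. f a (\<epsilon>t (\<epsilon>s (\<epsilon>s' r) * b)))"
    by (simp add: et_es'_mult)
  also have "\<dots> = sw (\<epsilon>s (\<epsilon>s' r)) (\<lambda>a b. f a (\<epsilon>t b))"
    by (rule sw_es_left[symmetric]) (intro L)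
  also have "\<dots> = sw 1 (\<lambda>a b. f (a * \<epsilon>s' r) b)"
    by (simp add: sw_et_second[OF f])
  finally show ?thesis by simp
qed

text \<open>\<Delta>(h) = \<Delta>(h) \<Delta>(1) reduces this to \<Delta>(1). It is the condition
  for \<Gamma> to take values in the product over R.\<close>

lemma sw_balanced:
  assumes f: "bform scale f"
  shows "sw h (\<lambda>a b. f (a * \<epsilon>s' r) b) = sw h (\<lambda>a b. f a (b * \<epsilon>t r))"
proof -
  note L = lin_intros f lform_comp[OF bform1[OF f]] lform_comp[OF bform2[OF f]]
  have "sw (h * 1) (\<lambda>a b. f (a * \<epsilon>s' r) b)
      = sw h (\<lambda>a b. sw 1 (\<lambda>c d. f (a * (c * \<epsilon>s' r)) (b * d)))"
    by (subst sw_mult) (intro L, simp only: mult.assoc)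
  also have "\<dots> = sw h (\<lambda>a b. sw 1 (\<lambda>c d. f (a * c) (b * (d * \<epsilon>t r))))"
    by (subst sw_one_balanced) (intro L, rule refl)
  also have "\<dots> = sw (h * 1) (\<lambda>a b. f a (b * \<epsilon>t r))"
    by (subst sw_mult) (intro L, simp only: mult.assoc)
  finally show ?thesis by simp
qed

text \<open>Writing out \<open>\<epsilon>s\<close> gives g_1 1_1 \<epsilon>(g_2 1_2), the counit on
  the second leg of \<Delta>(g) \<Delta>(1) = \<Delta>(g). The next two use \<Delta>(1)
  \<Delta>(g).\<close>

lemma sw_mult_es: "lform scale \<phi> \<Longrightarrow> sw g (\<lambda>a b. \<phi> (a * \<epsilon>s b)) = \<phi> g"
proof -
  assume \<phi>: "lform scale \<phi>"
  note L = lin_intros lform_comp[OF \<phi>]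
  have "sw g (\<lambda>a b. \<phi> (a * \<epsilon>s b)) = sw g (\<lambda>a b. sw 1 (\<lambda>c d. \<epsilon> (b * d) * \<phi> (a * c)))"
    by (subst lform_es[of "\<lambda>u. \<phi> (_ * u)"]) (intro L, rule refl)
  also have "\<dots> = sw (g * 1) (\<lambda>a b. \<epsilon> b * \<phi> a)"
    by (rule sw_mult[symmetric]) (intro L)
  finally show ?thesis by (simp add: mult.commute[of "\<epsilon> _"] sw_counit_right[OF \<phi>])
qed

lemma sw_et_mult: "lform scale \<phi> \<Longrightarrow> sw g (\<lambda>a b. \<phi> (\<epsilon>t a * b)) = \<phi> g"
proof -
  assume \<phi>: "lform scale \<phi>"
  note L = lin_intros lform_comp[OF \<phi>]
  have "sw g (\<lambda>a b. \<phi> (\<epsilon>t a * b)) = sw g (\<lambda>a b. sw 1 (\<lambda>c d. \<epsilon> (c * a) * \<phi> (d * b)))"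
    by (subst lform_et[of "\<lambda>u. \<phi> (u * _)"]) (intro L, rule refl)
  also have "\<dots> = sw 1 (\<lambda>c d. sw g (\<lambda>a b. \<epsilon> (c * a) * \<phi> (d * b)))"
    by (rule sw_swap)
  also have "\<dots> = sw (1 * g) (\<lambda>a b. \<epsilon> a * \<phi> b)"
    by (rule sw_mult[symmetric]) (intro L)
  finally show ?thesis by (simp add: sw_counit_left[OF \<phi>])
qed

lemma sw_es'_mult: "lform scale \<phi> \<Longrightarrow> sw g (\<lambda>a b. \<phi> (\<epsilon>s' b * a)) = \<phi> g"
proof -
  assume \<phi>: "lform scale \<phi>"
  note L = lin_intros lform_comp[OF \<phi>]
  have "sw g (\<lambda>a b. \<phi> (\<epsilon>s' b * a)) = sw g (\<lambda>a b. sw 1 (\<lambda>c d. \<epsilon> (d * b) * \<phi> (c * a)))"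
    by (subst lform_es'[of "\<lambda>u. \<phi> (u * _)"]) (intro L, rule refl)
  also have "\<dots> = sw 1 (\<lambda>c d. sw g (\<lambda>a b. \<epsilon> (d * b) * \<phi> (c * a)))"
    by (rule sw_swap)
  also have "\<dots> = sw (1 * g) (\<lambda>a b. \<epsilon> b * \<phi> a)"
    by (rule sw_mult[symmetric]) (intro L)
  finally show ?thesis by (simp add: mult.commute[of "\<epsilon> _"] sw_counit_right[OF \<phi>])
qed

text \<open>In 1'_1 \<epsilon>(1'_2 1_1) \<otimes> 1_2 the two copies of \<Delta>(1) merge by
  \<open>sw_one1\<close>, and the counit removes the middle leg.\<close>

lemma sw_one_es'_first:
  assumes f: "bform scale f"
  shows "sw 1 (\<lambda>a b. f (\<epsilon>s' a) b) = sw 1 f"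
proof -
  note L = lin_intros f lform_comp[OF bform1[OF f]] lform_comp[OF bform2[OF f]]
  have "sw 1 (\<lambda>a b. f (\<epsilon>s' a) b) = sw 1 (\<lambda>a b. sw 1 (\<lambda>c d. \<epsilon> (d * a) * f c b))"
    by (subst lform_es'[of "\<lambda>u. f u _"]) (intro L, rule refl)
  also have "\<dots> = sw 1 (\<lambda>c d. sw 1 (\<lambda>a b. \<epsilon> (d * a) * f c b))"
    by (rule sw_swap)
  also have "\<dots> = sw 1 (\<lambda>c d. sw d (\<lambda>p q. \<epsilon> p * f c q))"
    by (rule sw_one1[of "\<lambda>c u b. \<epsilon> u * f c b", symmetric]) (intro L)
  also have "\<dots> = sw 1 f"
    by (subst sw_counit_left) (intro L, rule refl)
  finally show ?thesis .
qed

end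

lemma ev_cong: "(\<And>a b. (a, b) \<in> Poly_Mapping.keys x \<Longrightarrow> f a b = g a b) \<Longrightarrow> ev f x = ev g x"
  unfolding ev_def by (rule K.lin_ext_cong) auto

lemma ev_formal_mult_op:
  "ev f (formal_mult (\<lambda>(r, s) (r', s'). (r * r', s' * s)) x y)
    = ev (\<lambda>r s. ev (\<lambda>r' s'. f (r * r') (s' * s)) y) x"
  by (simp add: ev_def formal_mult_def K.lin_ext_lin_ext case_prod_unfold)

lemma bilinear_relators_mono: "bilinear_relators s A s B \<subseteq> bilinear_relators s UNIV s UNIV"
  unfolding bilinear_relators_def by blast

section \<open>The associated bialgebra over the target subalgebra\<close>

sublocale weak_bialgebra \<subseteq> xR: xR_data scale target_subalgebra scale assoc_eta assoc_Gamma assoc_C .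

context weak_bialgebra
begin

lemma target_iff: "y \<in> target_subalgebra \<longleftrightarrow> \<epsilon>t y = y"
  unfolding target_subalgebra_def by (metis et_et rangeE rangeI)

text \<open>The product \<open>a * \<epsilon>s' b\<close> is bilinear, so the representative chosen
  in \<open>assoc_eta\<close> does not affect the value.\<close>

lemma assoc_eta_coset: "assoc_eta (x +o xR.Re_rel) = lin_ext scale (\<lambda>(a, b). a * \<epsilon>s' b) x"
proof (rule eq_by_lforms)
  fix \<phi> :: "'h \<Rightarrow> 'k" assume \<phi>: "lform scale \<phi>"
  let ?f = "\<lambda>a b. \<phi> (a * \<epsilon>s' b)"
  have "bform scale ?f" by (intro lin_intros lform_comp[OF \<phi>])
  then have "\<forall>b\<in>bilinear_relators scale target_subalgebra scale target_subalgebra. ev ?f b = 0"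
    using bilinear_relators_ev_iff[of scale ?f] bilinear_relators_mono by blast
  moreover have "rep (x +o xR.Re_rel) +o xR.Re_rel = x +o xR.Re_rel"
    by (simp add: rep_coset xR.Re_rel_def free_space.subspace_span)
  ultimately have "ev ?f (rep (x +o xR.Re_rel)) = ev ?f x"
    unfolding xR.Re_rel_def coset_eq_iff_ev by blast
  then show "\<phi> (assoc_eta (x +o xR.Re_rel)) = \<phi> (lin_ext scale (\<lambda>(a, b). a * \<epsilon>s' b) x)"
    by (simp add: assoc_eta_def lform_expand[OF \<phi>])
qed

lemma lform_assoc_eta:
  "lform scale \<phi> \<Longrightarrow> \<phi> (assoc_eta (x +o xR.Re_rel)) = ev (\<lambda>a b. \<phi> (a * \<epsilon>s' b)) x"
  by (simp add: assoc_eta_coset lform_expand)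

lemma base_eq [simp]: "xR.base r = r"
  and base_op_eq [simp]: "xR.base_op r = \<epsilon>s' r"
  by (simp_all add: xR.base_def xR.base_op_def assoc_eta_coset)

text \<open>These are the linear forms on H \<diamond> H. A base element is written
  \<open>\<epsilon>t r\<close> with \<open>r\<close> arbitrary, and its opposite acts as
  \<open>\<epsilon>s' (\<epsilon>t r)\<close>, which is \<open>\<epsilon>s' r\<close>.\<close>

definition diamond_form :: "('h \<Rightarrow> 'h \<Rightarrow> 'k) \<Rightarrow> bool"
  where "diamond_form f \<longleftrightarrow> bform scale f \<and> (\<forall>r m n. f (\<epsilon>s' r * m) n = f m (\<epsilon>t r * n))"

definition diamond3_form :: "('h \<Rightarrow> 'h \<Rightarrow> 'h \<Rightarrow> 'k) \<Rightarrow> bool"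
  where "diamond3_form f \<longleftrightarrow> tform scale f \<and> (\<forall>r m n p. f (\<epsilon>s' r * m) n p = f m (\<epsilon>t r * n) p)
    \<and> (\<forall>r m n p. f m (\<epsilon>s' r * n) p = f m n (\<epsilon>t r * p))"

definition op_tensor_form :: "('h \<Rightarrow> 'h \<Rightarrow> 'k) \<Rightarrow> bool"
  where "op_tensor_form f \<longleftrightarrow> bform scale f \<and> (\<forall>r m n. f (m * \<epsilon>s' r) n = f m (\<epsilon>s' r * n))"

lemma ball_target: "(\<forall>r\<in>target_subalgebra. P r) \<longleftrightarrow> (\<forall>r. P (\<epsilon>t r))"
  by (auto simp: target_subalgebra_def)

lemma diamond_rel_eq_iff:
  "x +o xR.diamond_rel = y +o xR.diamond_rel \<longleftrightarrow> (\<forall>f. diamond_form f \<longrightarrow> ev f x = ev f y)"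
proof -
  have "(\<forall>b\<in>bilinear_relators scale UNIV scale UNIV
      \<union> {pure (xR.base_op r * m, n) - pure (m, xR.base r * n) | r m n. r \<in> target_subalgebra}. ev f b = 0)
    \<longleftrightarrow> diamond_form f" for f
    unfolding ball_Un bilinear_relators_ev_iff diamond_form_def
    unfolding ball_relators3
    using ball_target[of "\<lambda>r. \<forall>m n. f (\<epsilon>s' r * m) n = f m (r * n)"]
    by (simp add: ev_diff Ball_def)
  then show ?thesis unfolding xR.diamond_rel_def coset_eq_iff_ev by simp
qed

lemma op_tensor_rel_eq_iff:
  "x +o xR.op_tensor_rel = y +o xR.op_tensor_rel \<longleftrightarrow> (\<forall>f. op_tensor_form f \<longrightarrow> ev f x = ev f y)"
proof -
  have "(\<forall>b\<in>bilinear_relators scale UNIV scale UNIV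
      \<union> {pure (g * xR.base_op r, h) - pure (g, xR.base_op r * h) | r g h. r \<in> target_subalgebra}. ev f b = 0)
    \<longleftrightarrow> op_tensor_form f" for f
    unfolding ball_Un bilinear_relators_ev_iff op_tensor_form_def
    unfolding ball_relators3
    using ball_target[of "\<lambda>r. \<forall>m n. f (m * \<epsilon>s' r) n = f m (\<epsilon>s' r * n)"]
    by (simp add: ev_diff Ball_def)
  then show ?thesis unfolding xR.op_tensor_rel_def coset_eq_iff_ev by simp
qed

lemma diamond3_rel_eqI:
  assumes "\<And>f. diamond3_form f \<Longrightarrow> ev3 f x = ev3 f y"
  shows "x +o xR.diamond3_rel = y +o xR.diamond3_rel"
proof -
  have "diamond3_form f" if "\<forall>b\<in>trilinear_relators scale
      \<union> {pure (xR.base_op r * m, n, p) - pure (m, xR.base r * n, p) | r m n p. r \<in> target_subalgebra}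
      \<union> {pure (m, xR.base_op r * n, p) - pure (m, n, xR.base r * p) | r m n p. r \<in> target_subalgebra}.
      ev3 f b = 0" for f
    using that
    unfolding ball_Un trilinear_relators_ev3_iff diamond3_form_def
    unfolding ball_relators4
    using ball_target[of "\<lambda>r. \<forall>m n p. f (\<epsilon>s' r * m) n p = f m (r * n) p"]
      ball_target[of "\<lambda>r. \<forall>m n p. f m (\<epsilon>s' r * n) p = f m n (r * p)"]
    by (simp add: ev3_diff Ball_def)
  then show ?thesis using assms unfolding xR.diamond3_rel_def coset_eq_iff_ev3 by simp
qed

lemma rep_diamond_coset: "diamond_form f \<Longrightarrow> ev f (rep (x +o xR.diamond_rel)) = ev f x"
  using diamond_rel_eq_iff[of "rep (x +o xR.diamond_rel)" x]
  by (simp add: rep_coset xR.diamond_rel_def free_space.subspace_span)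

lemma rep_op_tensor_coset: "op_tensor_form f \<Longrightarrow> ev f (rep (x +o xR.op_tensor_rel)) = ev f x"
  using op_tensor_rel_eq_iff[of "rep (x +o xR.op_tensor_rel)" x]
  by (simp add: rep_coset xR.op_tensor_rel_def free_space.subspace_span)

lemma ev_rep_Gamma: "diamond_form f \<Longrightarrow> ev f (rep (assoc_Gamma h)) = sw h f"
  by (simp add: assoc_Gamma_def rep_diamond_coset sw_def)

lemma Gamma_eqI: "(\<And>f. diamond_form f \<Longrightarrow> sw h f = ev f x) \<Longrightarrow> assoc_Gamma h = x +o xR.diamond_rel"
  unfolding assoc_Gamma_def diamond_rel_eq_iff by (simp add: sw_def)

lemma diamond_form_bform: "diamond_form f \<Longrightarrow> bform scale f"
  by (simp add: diamond_form_def)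

lemma diamond_form_balanced: "diamond_form f \<Longrightarrow> f (\<epsilon>s' r * m) n = f m (\<epsilon>t r * n)"
  by (simp add: diamond_form_def)

lemma op_tensor_form_bform: "op_tensor_form f \<Longrightarrow> bform scale f"
  by (simp add: op_tensor_form_def)

lemma op_tensor_form_balanced: "op_tensor_form f \<Longrightarrow> f (m * \<epsilon>s' r) n = f m (\<epsilon>s' r * n)"
  by (simp add: op_tensor_form_def)

lemma diamond_formI: "bform scale f \<Longrightarrow> (\<And>r m n. f (\<epsilon>s' r * m) n = f m (\<epsilon>t r * n)) \<Longrightarrow> diamond_form f"
  by (simp add: diamond_form_def)

lemma op_tensor_formI: "bform scale f \<Longrightarrow> (\<And>r m n. f (m * \<epsilon>s' r) n = f m (\<epsilon>s' r * n)) \<Longrightarrow> op_tensor_form f"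
  by (simp add: op_tensor_form_def)

section \<open>Structure maps of the associated bialgebra\<close>

lemma diamond_form_mult_right:
  assumes "diamond_form f" shows "diamond_form (\<lambda>a b. f (a * c) (b * d))"
proof -
  note f = diamond_form_bform[OF assms]
  show ?thesis
    by (rule diamond_formI) (intro lin_intros lform_comp[OF bform1[OF f]] lform_comp[OF bform2[OF f]],
      simp add: mult.assoc diamond_form_balanced[OF assms])
qed

text \<open>The first leg of \<Delta>(1) is fixed by \<open>\<epsilon>s'\<close>, so balancing moves
  it across as \<epsilon>t(1_1), where it cancels by \<epsilon>t(1_1) 1_2 = 1. This makes \<Gamma>
  unital.\<close>

lemma sw_one_diamond_form:
  assumes "diamond_form f" shows "sw 1 (\<lambda>a b. f (a * m) (b * n)) = f m n"
proof -
  note f = diamond_form_bform[OF assms]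
  note L = lin_intros f lform_comp[OF bform1[OF f]] lform_comp[OF bform2[OF f]]
  have "sw 1 (\<lambda>a b. f (a * m) (b * n)) = sw 1 (\<lambda>a b. f (\<epsilon>s' a * m) (b * n))"
    by (rule sw_one_es'_first[symmetric]) (intro L)
  also have "\<dots> = sw 1 (\<lambda>a b. f m (\<epsilon>t a * b * n))"
    by (simp only: diamond_form_balanced[OF assms] mult.assoc)
  also have "\<dots> = f m (1 * n)"
    by (rule sw_et_mult) (intro L)
  finally show ?thesis by simp
qed

lemma Gamma_xR: "assoc_Gamma l \<in> xR.xR_product"
proof -
  have "ev f (lin_ext fscale (\<lambda>(m, n). pure (m * xR.base_op (\<epsilon>t s), n)) (rep (assoc_Gamma l)))
      = ev f (lin_ext fscale (\<lambda>(m, n). pure (m, n * xR.base (\<epsilon>t s))) (rep (assoc_Gamma l)))"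
    if "diamond_form f" for s f
  proof -
    have "diamond_form (\<lambda>m n. f (m * \<epsilon>s' s) n)" "diamond_form (\<lambda>m n. f m (n * \<epsilon>t s))"
      using diamond_form_mult_right[OF that, of "\<epsilon>s' s" 1] diamond_form_mult_right[OF that, of 1 "\<epsilon>t s"] by simp_all
    then show ?thesis
      by (simp add: ev_lin_ext ev_rep_Gamma sw_balanced[OF diamond_form_bform[OF that]])
  qed
  then show ?thesis
    unfolding xR.xR_product_def mem_Collect_eq ball_target diamond_rel_eq_iff
    by (simp add: xR.diamond_def assoc_Gamma_def)
qed

lemma Gamma_mult:
  "assoc_Gamma (g * h) = formal_mult mult2 (rep (assoc_Gamma g)) (rep (assoc_Gamma h)) +o xR.diamond_rel"
proof (rule Gamma_eqI)
  fix f assume d: "diamond_form f"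
  note f = diamond_form_bform[OF d]
  note L = lin_intros f lform_comp[OF bform1[OF f]] lform_comp[OF bform2[OF f]]
  \<comment> \<open>Multiplying by \<Delta>(g) from the left turns \<open>f\<close> into another
    form on H \<diamond> H, by \<open>sw_balanced\<close>; hence the product is independent of the
    representative of \<Gamma>(h).\<close>
  have "diamond_form (\<lambda>c d. sw g (\<lambda>a b. f (a * c) (b * d)))"
  proof (rule diamond_formI)
    show "bform scale (\<lambda>c d. sw g (\<lambda>a b. f (a * c) (b * d)))" by (intro L)
    show "sw g (\<lambda>a b. f (a * (\<epsilon>s' r * m)) (b * n)) = sw g (\<lambda>a b. f (a * m) (b * (\<epsilon>t r * n)))"
      for r m n
      unfolding mult.assoc[symmetric] by (rule sw_balanced[of "\<lambda>a b. f (a * m) (b * n)"]) (intro L)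
  qed
  then have "sw h (\<lambda>c d. sw g (\<lambda>a b. f (a * c) (b * d)))
      = ev (\<lambda>c d. ev (\<lambda>a b. f (a * c) (b * d)) (rep (assoc_Gamma g))) (rep (assoc_Gamma h))"
    by (simp only: ev_rep_Gamma diamond_form_mult_right[OF d])
  then show "sw (g * h) f = ev f (formal_mult mult2 (rep (assoc_Gamma g)) (rep (assoc_Gamma h)))"
    unfolding ev_formal_mult sw_mult[OF f] by (subst sw_swap, subst ev_swap)
qed

text \<open>Target and source factors move out of \<Delta> to different legs, and the remaining
  \<Delta>(1) is trivial in H \<diamond> H.\<close>

lemma sw_target_source:
  assumes d: "diamond_form f" shows "sw (\<epsilon>t r * \<epsilon>s' s) f = f (\<epsilon>t r) (\<epsilon>s' s)"
proof -
  note f = diamond_form_bform[OF d]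
  note L = lin_intros f lform_comp[OF bform1[OF f]] lform_comp[OF bform2[OF f]]
  have "sw (\<epsilon>t r * \<epsilon>s' s) f = sw (\<epsilon>t r) (\<lambda>a b. f a (b * \<epsilon>s' s))"
    using sw_mult_es_right[OF f, of "\<epsilon>t r" "\<epsilon>s' s"] by simp
  also have "\<dots> = sw 1 (\<lambda>a b. f (a * \<epsilon>t r) (b * \<epsilon>s' s))"
    by (rule sw_et_right) (intro L)
  also have "\<dots> = f (\<epsilon>t r) (\<epsilon>s' s)"
    by (rule sw_one_diamond_form[OF d])
  finally show ?thesis .
qed

lemma formal_onD:
  "x \<in> formal_on target_subalgebra target_subalgebra \<Longrightarrow> (a, b) \<in> Poly_Mapping.keys x
    \<Longrightarrow> \<epsilon>t a = a \<and> \<epsilon>t b = b"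
  by (auto simp: formal_on_def target_iff)

lemma Gamma_coassoc:
  "iter_left assoc_Gamma l +o xR.diamond3_rel = iter_right assoc_Gamma l +o xR.diamond3_rel"
proof (rule diamond3_rel_eqI)
  fix f assume d: "diamond3_form f"
  then have T: "tform scale f" by (simp add: diamond3_form_def)
  note L = lin_intros lform_comp[OF tform1[OF T]] lform_comp[OF tform2[OF T]] lform_comp[OF tform3[OF T]]
  have d1: "diamond_form (\<lambda>a b. f a b c)" and d2: "diamond_form (\<lambda>b c. f a b c)" for a c
    using d unfolding diamond3_form_def by (auto intro!: diamond_formI L)
  \<comment> \<open>The outer \<Gamma> can be evaluated through \<Delta> once the inner evaluation
    is balanced: \<Delta> puts a left source factor on the second leg and a left target factor on
    the first, and the balancing of \<open>f\<close> carries it on.\<close>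
  have "bform scale (\<lambda>c d. f c d b)" for b by (intro L)
  from sw_mult_es_left[OF this, of "\<epsilon>s' _"]
  have dl: "diamond_form (\<lambda>a b. sw a (\<lambda>c d. f c d b))"
    using d by (intro diamond_formI) (intro L, simp add: diamond3_form_def)
  have "bform scale (\<lambda>c d. f a c d)" for a by (intro L)
  from sw_mult_et_left[OF this]
  have dr: "diamond_form (\<lambda>a b. sw b (\<lambda>c d. f a c d))"
    using d by (intro diamond_formI) (intro L, simp add: diamond3_form_def)
  show "ev3 f (iter_left assoc_Gamma l) = ev3 f (iter_right assoc_Gamma l)"
    by (simp only: iter_left_def iter_right_def ev3_lin_ext ev3_pure ev_rep_Gamma[OF d1]
      ev_rep_Gamma[OF d2] ev_rep_Gamma[OF dl] ev_rep_Gamma[OF dr] sw_coassoc[OF T])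
qed

lemma et_zero: "\<epsilon>t 0 = 0"
  using lmap_et0 unfolding lmap_def by (metis scale_zero_left)

theorem assoc_xR_bialgebra:
  "xR_bialgebra scale target_subalgebra scale assoc_eta assoc_Gamma assoc_C"
proof unfold_locales
  let ?R = target_subalgebra
  show "subspace ?R"
    using lmap_et0 et_zero by (simp add: subspace_def target_iff lmap_def)
  show "1 \<in> ?R" by (simp add: target_iff)
  show "r * s \<in> ?R" if "r \<in> ?R" "s \<in> ?R" for r s
    using that et_closed[of r s] by (simp add: target_iff)
  show "assoc_eta ((x + y) +o xR.Re_rel) = assoc_eta (x +o xR.Re_rel) + assoc_eta (y +o xR.Re_rel)" for x y
    by (simp add: assoc_eta_coset lin_ext_add)
  show "assoc_eta (fscale c x +o xR.Re_rel) = scale c (assoc_eta (x +o xR.Re_rel))" for c x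
    by (simp add: assoc_eta_coset lin_ext_fscale)
  show "assoc_eta (pure (1, 1) +o xR.Re_rel) = 1"
    by (simp add: assoc_eta_coset)
  show "assoc_eta (formal_mult (\<lambda>(r, s) (r', s'). (r * r', s' * s)) x y +o xR.Re_rel)
      = assoc_eta (x +o xR.Re_rel) * assoc_eta (y +o xR.Re_rel)"
    if x: "x \<in> formal_on ?R ?R" and y: "y \<in> formal_on ?R ?R" for x y
  proof (rule eq_by_lforms)
    fix \<phi> :: "'h \<Rightarrow> 'k" assume \<phi>: "lform scale \<phi>"
    note L = lin_intros lform_comp[OF \<phi>]
    \<comment> \<open>Anti-multiplicativity of \<open>\<epsilon>s'\<close> undoes the reversed
      order, and target elements commute with source elements.\<close>
    have *: "r * r' * \<epsilon>s' (s' * s) = r * \<epsilon>s' s * (r' * \<epsilon>s' s')"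
      if "\<epsilon>t r = r" "\<epsilon>t s = s" "\<epsilon>t r' = r'" "\<epsilon>t s' = s'" for r s r' s'
      using that et_es'_commute[of r' s] es'_antimult[of s' s] by (simp add: mult.assoc) (metis mult.assoc)
    have "\<phi> (assoc_eta (x +o xR.Re_rel) * assoc_eta (y +o xR.Re_rel))
        = ev (\<lambda>r s. \<phi> (r * \<epsilon>s' s * assoc_eta (y +o xR.Re_rel))) x"
      by (rule lform_assoc_eta) (intro L)
    also have "\<dots> = ev (\<lambda>r s. ev (\<lambda>r' s'. \<phi> (r * \<epsilon>s' s * (r' * \<epsilon>s' s'))) y) x"
      by (subst lform_assoc_eta) (intro L, rule refl)
    also have "\<dots> = ev (\<lambda>r s. ev (\<lambda>r' s'. \<phi> (r * r' * \<epsilon>s' (s' * s))) y) x"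
      by (intro ev_cong) (use formal_onD[OF x] formal_onD[OF y] in \<open>simp add: *\<close>)
    finally show "\<phi> (assoc_eta (formal_mult (\<lambda>(r, s) (r', s'). (r * r', s' * s)) x y +o xR.Re_rel))
        = \<phi> (assoc_eta (x +o xR.Re_rel) * assoc_eta (y +o xR.Re_rel))"
      by (simp only: lform_assoc_eta[OF \<phi>] ev_formal_mult_op)
  qed
  show "assoc_Gamma l \<in> xR.xR_product" for l by (rule Gamma_xR)
  show "assoc_Gamma (g + h) = (rep (assoc_Gamma g) + rep (assoc_Gamma h)) +o xR.diamond_rel" for g h
    by (rule Gamma_eqI) (simp add: ev_add ev_rep_Gamma sw_add diamond_form_bform)
  show "assoc_Gamma (scale c h) = fscale c (rep (assoc_Gamma h)) +o xR.diamond_rel" for c h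
    by (rule Gamma_eqI) (simp add: ev_fscale ev_rep_Gamma sw_scale diamond_form_bform)
  show "assoc_Gamma 1 = pure (1, 1) +o xR.diamond_rel"
    by (rule Gamma_eqI) (use sw_one_diamond_form[of _ 1 1] in simp)
  show "assoc_Gamma (g * h)
      = formal_mult mult2 (rep (assoc_Gamma g)) (rep (assoc_Gamma h)) +o xR.diamond_rel" for g h
    by (rule Gamma_mult)
  show "assoc_Gamma (assoc_eta (x +o xR.Re_rel))
      = lin_ext fscale (\<lambda>(r, s). pure (xR.base r, xR.base_op s)) x +o xR.diamond_rel"
    if x: "x \<in> formal_on ?R ?R" for x
  proof (rule Gamma_eqI)
    fix f assume d: "diamond_form f"
    have "sw (assoc_eta (x +o xR.Re_rel)) f = ev (\<lambda>r s. sw (r * \<epsilon>s' s) f) x"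
      by (rule lform_assoc_eta) (intro lin_intros diamond_form_bform[OF d])
    also have "\<dots> = ev (\<lambda>r s. f r (\<epsilon>s' s)) x"
      by (rule ev_cong) (use formal_onD[OF x] sw_target_source[OF d] in metis)
    finally show "sw (assoc_eta (x +o xR.Re_rel)) f
        = ev f (lin_ext fscale (\<lambda>(r, s). pure (xR.base r, xR.base_op s)) x)"
      by (simp add: ev_lin_ext)
  qed
  show "assoc_C l t \<in> ?R" for l t by (simp add: assoc_C_def target_iff)
  show "assoc_C l (t + t') = assoc_C l t + assoc_C l t'" for l t t'
    using lmap_et0 by (simp add: assoc_C_def lmap_def distrib_left)
  show "assoc_C l (scale c t) = scale c (assoc_C l t)" for l c t
    using lmap_et0 by (simp add: assoc_C_def lmap_def scale_mult_right)
  show "assoc_C (g + h) t = assoc_C g t + assoc_C h t" for g h t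
    using lmap_et0 by (simp add: assoc_C_def lmap_def distrib_right)
  show "assoc_C (scale c h) t = scale c (assoc_C h t)" for c h t
    using lmap_et0 by (simp add: assoc_C_def lmap_def scale_mult_left)
  show "assoc_C 1 t = t" if "t \<in> ?R" for t
    using that by (simp add: assoc_C_def target_iff)
  show "assoc_C (g * h) t = assoc_C g (assoc_C h t)" for g h t
    by (simp add: assoc_C_def et_mult_et mult.assoc)
  show "assoc_C (assoc_eta (x +o xR.Re_rel)) t = lin_ext scale (\<lambda>(r, s). r * t * s) x"
    if x: "x \<in> formal_on ?R ?R" and t: "t \<in> ?R" for x t
  proof (rule eq_by_lforms)
    fix \<phi> :: "'h \<Rightarrow> 'k" assume \<phi>: "lform scale \<phi>"
    \<comment> \<open>The target element \<open>r\<close> can be pulled out of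
      \<open>\<epsilon>t\<close>, and \<open>et_es'_mult\<close> turns the opposite of
      \<open>s\<close> into right multiplication by \<open>s\<close>.\<close>
    have "\<epsilon>t (r * \<epsilon>s' s * t) = r * t * s" if "\<epsilon>t r = r \<and> \<epsilon>t s = s" for r s
      using that t et_et_mult[of r "\<epsilon>s' s * t"] et_es'_mult[of s t] by (simp add: target_iff mult.assoc)
    then have "ev (\<lambda>r s. \<phi> (\<epsilon>t (r * \<epsilon>s' s * t))) x = ev (\<lambda>r s. \<phi> (r * t * s)) x"
      by (intro ev_cong) (use formal_onD[OF x] in metis)
    moreover have "\<phi> (\<epsilon>t (assoc_eta (x +o xR.Re_rel) * t)) = ev (\<lambda>r s. \<phi> (\<epsilon>t (r * \<epsilon>s' s * t))) x"
      by (rule lform_assoc_eta) (intro lin_intros lform_comp[OF \<phi>])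
    ultimately show "\<phi> (assoc_C (assoc_eta (x +o xR.Re_rel)) t)
        = \<phi> (lin_ext scale (\<lambda>(r, s). r * t * s) x)"
      by (simp add: assoc_C_def lform_expand[OF \<phi>])
  qed
  show "iter_left assoc_Gamma l +o xR.diamond3_rel = iter_right assoc_Gamma l +o xR.diamond3_rel" for l
    by (rule Gamma_coassoc)
  show "lin_ext scale (\<lambda>(l1, l2). xR.base_op (assoc_C l2 1) * l1) (rep (assoc_Gamma l)) = l" for l
  proof (rule eq_by_lforms)
    fix \<phi> :: "'h \<Rightarrow> 'k" assume \<phi>: "lform scale \<phi>"
    \<comment> \<open>The value of \<open>assoc_C b\<close> at 1 is \<open>\<epsilon>t b\<close>,
      with opposite \<open>\<epsilon>s' b\<close>; the form is balanced since
      \<open>\<epsilon>s'\<close> reverses products of target elements.\<close>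
    have "diamond_form (\<lambda>a b. \<phi> (\<epsilon>s' b * a))"
    proof (rule diamond_formI)
      show "\<phi> (\<epsilon>s' n * (\<epsilon>s' r * m)) = \<phi> (\<epsilon>s' (\<epsilon>t r * n) * m)" for r m n
        using es'_antimult[of r n] es'_et[of "\<epsilon>t r * n"] es'_et[of "\<epsilon>t r * \<epsilon>t n"]
        by (simp add: mult.assoc[symmetric] et_et_mult)
    qed (intro lin_intros lform_comp[OF \<phi>])
    then show "\<phi> (lin_ext scale (\<lambda>(l1, l2). xR.base_op (assoc_C l2 1) * l1) (rep (assoc_Gamma l))) = \<phi> l"
      by (simp add: lform_expand[OF \<phi>] assoc_C_def ev_rep_Gamma sw_es'_mult[OF \<phi>])
  qed
  show "lin_ext scale (\<lambda>(l1, l2). xR.base (assoc_C l1 1) * l2) (rep (assoc_Gamma l)) = l" for l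
  proof (rule eq_by_lforms)
    fix \<phi> :: "'h \<Rightarrow> 'k" assume \<phi>: "lform scale \<phi>"
    have "diamond_form (\<lambda>a b. \<phi> (\<epsilon>t a * b))"
      by (rule diamond_formI) (intro lin_intros lform_comp[OF \<phi>], simp add: et_es'_mult mult.assoc)
    then show "\<phi> (lin_ext scale (\<lambda>(l1, l2). xR.base (assoc_C l1 1) * l2) (rep (assoc_Gamma l))) = \<phi> l"
      by (simp add: lform_expand[OF \<phi>] assoc_C_def ev_rep_Gamma sw_et_mult[OF \<phi>])
  qed
qed

section \<open>Antipodes and the canonical map\<close>

lemma diamond_form_mult_second: "diamond_form F \<Longrightarrow> diamond_form (\<lambda>a b. F a (b * h))"
  using diamond_form_mult_right[of F 1 h] by simp

lemma ev_canonical_map: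
  assumes d: "diamond_form F"
  shows "ev F (lin_ext fscale (\<lambda>(g, h). lin_ext fscale (\<lambda>(g1, g2). pure (g1, g2 * h)) (rep (assoc_Gamma g))) x)
    = ev (\<lambda>g h. sw g (\<lambda>a b. F a (b * h))) x"
  by (simp only: ev_lin_ext ev_pure ev_rep_Gamma[OF diamond_form_mult_second[OF d]])

text \<open>\<Delta> carries a right source factor of the left tensorand to its second leg, next to
  \<open>h\<close>; so the canonical map is well defined on the tensor product over the opposite
  base.\<close>

lemma op_tensor_form_canonical:
  assumes d: "diamond_form F"
  shows "op_tensor_form (\<lambda>g h. sw g (\<lambda>a b. F a (b * h)))"
proof (rule op_tensor_formI)
  note f = diamond_form_bform[OF d]
  note L = lin_intros f lform_comp[OF bform1[OF f]] lform_comp[OF bform2[OF f]]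
  show "bform scale (\<lambda>g h. sw g (\<lambda>a b. F a (b * h)))" by (intro L)
  have "bform scale (\<lambda>a b. F a (b * h))" for h by (intro L)
  from sw_mult_es_right[OF this, of _ "\<epsilon>s' _"]
  show "sw (m * \<epsilon>s' r) (\<lambda>a b. F a (b * n)) = sw m (\<lambda>a b. F a (b * (\<epsilon>s' r * n)))" for r m n
    by (simp add: mult.assoc)
qed

lemma ev_rep_canonical_map:
  assumes d: "diamond_form F"
  shows "ev F (rep (xR.canonical_map (x +o xR.op_tensor_rel))) = ev (\<lambda>g h. sw g (\<lambda>a b. F a (b * h))) x"
  by (simp only: xR.canonical_map_def rep_diamond_coset[OF d] ev_canonical_map[OF d]
    rep_op_tensor_coset[OF op_tensor_form_canonical[OF d]])

lemma canonical_map_eq_iff: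
  "xR.canonical_map (x +o xR.op_tensor_rel) = y +o xR.diamond_rel
    \<longleftrightarrow> (\<forall>F. diamond_form F \<longrightarrow> ev (\<lambda>g h. sw g (\<lambda>a b. F a (b * h))) x = ev F y)"
  unfolding xR.canonical_map_def diamond_rel_eq_iff
  by (simp only: ev_canonical_map rep_op_tensor_coset[OF op_tensor_form_canonical] cong: imp_cong)

definition is_antipode :: "('h \<Rightarrow> 'h) \<Rightarrow> bool"
  where "is_antipode S \<longleftrightarrow> Vector_Spaces.linear scale scale S \<and>
      (\<forall>h. lin_ext scale (\<lambda>(h1, h2). S h1 * h2) (rep (\<Delta> h)) = \<epsilon>s h) \<and>
      (\<forall>h. lin_ext scale (\<lambda>(h1, h2). h1 * S h2) (rep (\<Delta> h)) = \<epsilon>t h) \<and>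
      (\<forall>h. lin_ext scale (\<lambda>(h1, h2, h3). S h1 * h2 * S h3) (iter_left \<Delta> h) = S h)"

lemma weak_hopf_iff: "weak_hopf_algebra scale \<Delta> \<epsilon> \<longleftrightarrow> (\<exists>S. is_antipode S)"
  unfolding weak_hopf_algebra_def weak_hopf_algebra_axioms_def is_antipode_def
  using weak_bialgebra_axioms by blast

lemma linear_iff_lmap: "Vector_Spaces.linear scale scale S \<longleftrightarrow> lmap scale S"
proof
  assume "Vector_Spaces.linear scale scale S"
  then interpret S: Vector_Spaces.linear scale scale S .
  show "lmap scale S" by (simp add: lmap_def S.add S.scale)
next
  assume "lmap scale S"
  then show "Vector_Spaces.linear scale scale S"
    by (intro Vector_Spaces.linear.intro module_hom.intro module_hom_axioms.intro
      module_axioms vector_space_axioms) (auto simp: lmap_def)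
qed

lemma lform_iter_left:
  "lform scale \<phi> \<Longrightarrow> \<phi> (lin_ext scale (\<lambda>(h1, h2, h3). f h1 h2 h3) (iter_left \<Delta> h))
    = sw h (\<lambda>a b. sw a (\<lambda>c d. \<phi> (f c d b)))"
  using ev3_lin_ext[of "\<lambda>a b c. \<phi> (f a b c)"]
  by (simp add: lform_lin_ext iter_left_def ev3_def[symmetric] case_prod_unfold)
    (simp add: ev3_def K.lin_ext_lin_ext sw_def ev_def case_prod_unfold)

lemma is_antipode_iff:
  "is_antipode S \<longleftrightarrow> lmap scale S \<and>
    (\<forall>\<phi> h. lform scale \<phi> \<longrightarrow> sw h (\<lambda>a b. \<phi> (S a * b)) = \<phi> (\<epsilon>s h)) \<and>
    (\<forall>\<phi> h. lform scale \<phi> \<longrightarrow> sw h (\<lambda>a b. \<phi> (a * S b)) = \<phi> (\<epsilon>t h)) \<and>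
    (\<forall>\<phi> h. lform scale \<phi> \<longrightarrow> sw h (\<lambda>a b. sw a (\<lambda>c d. \<phi> (S c * d * S b))) = \<phi> (S h))"
proof -
  have "u = v \<longleftrightarrow> (\<forall>\<phi> :: 'h \<Rightarrow> 'k. lform scale \<phi> \<longrightarrow> \<phi> u = \<phi> v)" for u v :: 'h
    using eq_by_lforms by blast
  then show ?thesis
    unfolding is_antipode_def linear_iff_lmap
    by (simp only: lform_expand_sw lform_iter_left[where f = "\<lambda>a b c. S a * b * S c"] cong: imp_cong) blast
qed

section \<open>From an antipode to a bijective canonical map\<close>

lemma canonical_bij_if_antipode:
  assumes S: "is_antipode S"
  shows "bij_betw xR.canonical_map xR.op_tensor xR.diamond"
proof -
  have linS: "lmap scale S"
    and S1: "lform scale \<phi> \<Longrightarrow> sw h (\<lambda>a b. \<phi> (S a * b)) = \<phi> (\<epsilon>s h)"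
    and S2: "lform scale \<phi> \<Longrightarrow> sw h (\<lambda>a b. \<phi> (a * S b)) = \<phi> (\<epsilon>t h)"
    and S3: "lform scale \<phi> \<Longrightarrow> sw h (\<lambda>a b. sw a (\<lambda>c d. \<phi> (S c * d * S b))) = \<phi> (S h)"
    for \<phi> :: "'h \<Rightarrow> 'k" and h
    using S unfolding is_antipode_iff by auto
  \<comment> \<open>In S(h) = S(h_1) h_2 S(h_3) the last two factors collapse to \<epsilon>t after
    regrouping.\<close>
  have S_expand: "\<phi> (S h) = sw h (\<lambda>a b. \<phi> (S a * \<epsilon>t b))" if \<phi>: "lform scale \<phi>" for \<phi> and h
  proof -
    note L = lin_intros lform_comp[OF \<phi>] lmap_comp[OF linS]
    have "\<phi> (S h) = sw h (\<lambda>a b. sw b (\<lambda>c d. \<phi> (S a * c * S d)))"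
      unfolding S3[OF \<phi>, symmetric] by (rule sw_coassoc) (intro L)
    also have "\<dots> = sw h (\<lambda>a b. \<phi> (S a * \<epsilon>t b))"
    proof -
      have "sw b (\<lambda>c d. \<phi> (S a * (c * S d))) = \<phi> (S a * \<epsilon>t b)" for a b
        by (rule S2) (intro L)
      then show ?thesis by (simp only: mult.assoc)
    qed
    finally show ?thesis .
  qed
  \<comment> \<open>\<Delta> carries the source factor to the second leg, where
    \<open>\<epsilon>t\<close> turns it into right multiplication by
    \<open>\<epsilon>t r\<close>.\<close>
  have S_es': "S (\<epsilon>s' r * m) = S m * \<epsilon>t r" for r m
  proof (rule eq_by_lforms)
    fix \<phi> :: "'h \<Rightarrow> 'k" assume \<phi>: "lform scale \<phi>"
    note L = lin_intros lform_comp[OF \<phi>] lmap_comp[OF linS]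
    have "\<phi> (S (\<epsilon>s' r * m)) = sw (\<epsilon>s (\<epsilon>s' r) * m) (\<lambda>a b. \<phi> (S a * \<epsilon>t b))"
      using S_expand[OF \<phi>] by simp
    also have "\<dots> = sw m (\<lambda>a b. \<phi> (S a * \<epsilon>t (\<epsilon>s (\<epsilon>s' r) * b)))"
      by (rule sw_mult_es_left) (intro L)
    also have "\<dots> = sw m (\<lambda>a b. \<phi> (S a * \<epsilon>t b * \<epsilon>t r))"
      by (simp add: et_es'_mult mult.assoc)
    also have "\<dots> = \<phi> (S m * \<epsilon>t r)"
      by (rule S_expand[of "\<lambda>u. \<phi> (u * \<epsilon>t r)", symmetric]) (intro L)
    finally show "\<phi> (S (\<epsilon>s' r * m)) = \<phi> (S m * \<epsilon>t r)" .
  qed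
  define G where "G Y = lin_ext fscale (\<lambda>(g, h). lin_ext fscale (\<lambda>(g1, g2). pure (g1, S g2 * h))
    (rep (\<Delta> g))) (rep Y) +o xR.op_tensor_rel" for Y
  have ev_G: "ev f (lin_ext fscale (\<lambda>(g, h). lin_ext fscale (\<lambda>(g1, g2). pure (g1, S g2 * h))
      (rep (\<Delta> g))) x) = ev (\<lambda>g h. sw g (\<lambda>a b. f a (S b * h))) x" for f and x :: "'h \<times> 'h \<Rightarrow>\<^sub>0 'k"
    by (simp only: ev_lin_ext ev_pure sw_def)
  \<comment> \<open>\<open>G\<close> is given on representatives; it is well defined because forms
    on its codomain pull back to forms on H \<diamond> H.\<close>
  have diamond_form_G: "diamond_form (\<lambda>g h. sw g (\<lambda>a b. f a (S b * h)))" if n: "op_tensor_form f" for f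
  proof (rule diamond_formI)
    note f = op_tensor_form_bform[OF n]
    note L = lin_intros f lform_comp[OF bform1[OF f]] lform_comp[OF bform2[OF f]] lmap_comp[OF linS]
    show "bform scale (\<lambda>g h. sw g (\<lambda>a b. f a (S b * h)))" by (intro L)
    have "bform scale (\<lambda>a b. f a (S b * h))" for h by (intro L)
    from sw_mult_es_left[OF this, of "\<epsilon>s' _"]
    show "sw (\<epsilon>s' r * m) (\<lambda>a b. f a (S b * n)) = sw m (\<lambda>a b. f a (S b * (\<epsilon>t r * n)))" for r m n
      by (simp add: S_es' mult.assoc)
  qed
  show ?thesis
  proof (rule bij_betw_byWitness[where f' = G])
    show "\<forall>X\<in>xR.op_tensor. G (xR.canonical_map X) = X"
    proof
      fix X assume "X \<in> xR.op_tensor"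
      then obtain x where X: "X = x +o xR.op_tensor_rel" by (auto simp: xR.op_tensor_def)
      show "G (xR.canonical_map X) = X"
        unfolding G_def X op_tensor_rel_eq_iff
      proof (intro allI impI)
        fix f assume n: "op_tensor_form f"
        note f = op_tensor_form_bform[OF n]
        note L = lin_intros f lform_comp[OF bform1[OF f]] lform_comp[OF bform2[OF f]] lmap_comp[OF linS]
        \<comment> \<open>g_1 \<otimes> S(g_2) g_3 h = g_1 \<otimes> \<epsilon>s(g_2) h = g_1
          \<epsilon>s(g_2) \<otimes> h = g \<otimes> h; the balancing applies since
          \<open>\<epsilon>s'\<close> fixes every value of \<open>\<epsilon>s\<close>.\<close>
        have "sw g (\<lambda>a b. sw a (\<lambda>c d. f c (S d * (b * h)))) = f g h" for g h
        proof -
          have "sw g (\<lambda>a b. sw a (\<lambda>c d. f c (S d * (b * h))))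
              = sw g (\<lambda>a b. sw b (\<lambda>c d. f a (S c * (d * h))))"
            by (rule sw_coassoc) (intro L)
          also have "\<dots> = sw g (\<lambda>a b. f a (\<epsilon>s b * h))"
          proof -
            have "sw b (\<lambda>c d. f a (S c * d * h)) = f a (\<epsilon>s b * h)" for a b
              by (rule S1) (intro L)
            then show ?thesis by (simp only: mult.assoc)
          qed
          also have "\<dots> = sw g (\<lambda>a b. f (a * \<epsilon>s b) h)"
            using op_tensor_form_balanced[OF n, of _ "\<epsilon>s _"] by simp
          also have "\<dots> = f g h"
            by (rule sw_mult_es) (intro L)
          finally show ?thesis .
        qed
        then show "ev f (lin_ext fscale (\<lambda>(g, h). lin_ext fscale (\<lambda>(g1, g2). pure (g1, S g2 * h))
            (rep (\<Delta> g))) (rep (xR.canonical_map (x +o xR.op_tensor_rel)))) = ev f x"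
          by (simp only: ev_G ev_rep_canonical_map[OF diamond_form_G[OF n]])
      qed
    qed
    show "\<forall>Y\<in>xR.diamond. xR.canonical_map (G Y) = Y"
    proof
      fix Y assume "Y \<in> xR.diamond"
      then obtain y where Y: "Y = y +o xR.diamond_rel" by (auto simp: xR.diamond_def)
      show "xR.canonical_map (G Y) = Y"
        unfolding G_def Y canonical_map_eq_iff
      proof (intro allI impI)
        fix f assume d: "diamond_form f"
        note f = diamond_form_bform[OF d]
        note L = lin_intros f lform_comp[OF bform1[OF f]] lform_comp[OF bform2[OF f]] lmap_comp[OF linS]
        \<comment> \<open>g_1 \<otimes> g_2 S(g_3) h = g_1 \<otimes> \<epsilon>t(g_2) h =
          \<epsilon>s'(g_2) g_1 \<otimes> h = g \<otimes> h.\<close>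
        have *: "sw g (\<lambda>a b. sw a (\<lambda>c d. f c (d * (S b * h)))) = f g h" for g h
        proof -
          have "sw g (\<lambda>a b. sw a (\<lambda>c d. f c (d * (S b * h))))
              = sw g (\<lambda>a b. sw b (\<lambda>c d. f a (c * (S d * h))))"
            by (rule sw_coassoc) (intro L)
          also have "\<dots> = sw g (\<lambda>a b. f a (\<epsilon>t b * h))"
          proof -
            have "sw b (\<lambda>c d. f a (c * S d * h)) = f a (\<epsilon>t b * h)" for a b
              by (rule S2) (intro L)
            then show ?thesis by (simp only: mult.assoc)
          qed
          also have "\<dots> = sw g (\<lambda>a b. f (\<epsilon>s' b * a) h)"
            by (simp only: diamond_form_balanced[OF d])
          also have "\<dots> = f g h"
            by (rule sw_es'_mult) (intro L)
          finally show ?thesis .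
        qed
        have "ev (\<lambda>g h. sw g (\<lambda>a b. sw a (\<lambda>c d. f c (d * (S b * h))))) (rep (y +o xR.diamond_rel)) = ev f y"
          unfolding * by (rule rep_diamond_coset[OF d])
        then show "ev (\<lambda>g h. sw g (\<lambda>a b. f a (b * h))) (lin_ext fscale (\<lambda>(g, h).
            lin_ext fscale (\<lambda>(g1, g2). pure (g1, S g2 * h)) (rep (\<Delta> g))) (rep (y +o xR.diamond_rel))) = ev f y"
          by (simp only: ev_G)
      qed
    qed
    show "xR.canonical_map ` xR.op_tensor \<subseteq> xR.diamond"
      by (auto simp: xR.canonical_map_def xR.diamond_def)
    show "G ` xR.diamond \<subseteq> xR.op_tensor"
      by (auto simp: G_def xR.op_tensor_def)
  qed
qed

section \<open>From a bijective canonical map to an antipode\<close>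

lemma antipode_if_canonical_bij:
  assumes bij: "bij_betw xR.canonical_map xR.op_tensor xR.diamond"
  shows "\<exists>S. is_antipode S"
proof -
  \<comment> \<open>The pullback of \<open>F\<close> along the canonical map \<beta>.\<close>
  define can :: "('h \<Rightarrow> 'h \<Rightarrow> 'k) \<Rightarrow> 'h \<Rightarrow> 'h \<Rightarrow> 'k"
    where "can F g h = sw g (\<lambda>a b. F a (b * h))" for F g h
  \<comment> \<open>Injectivity of \<beta> in dual form: the forms pulled back along \<beta>
    separate points.\<close>
  have inj: "ev f x = ev f y"
    if xy: "\<And>F. diamond_form F \<Longrightarrow> ev (can F) x = ev (can F) y" and f: "op_tensor_form f" for x y f
  proof -
    have "xR.canonical_map (x +o xR.op_tensor_rel) = xR.canonical_map (y +o xR.op_tensor_rel)"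
      unfolding xR.canonical_map_def diamond_rel_eq_iff
      using xy unfolding can_def
      by (simp only: ev_canonical_map rep_op_tensor_coset[OF op_tensor_form_canonical] simp_thms cong: imp_cong)
    then have "x +o xR.op_tensor_rel = y +o xR.op_tensor_rel"
      by (rule inj_onD[OF bij_betw_imp_inj_on[OF bij]]) (simp_all add: xR.op_tensor_def)
    then show ?thesis using f op_tensor_rel_eq_iff by blast
  qed
  have "\<exists>t. \<forall>F. diamond_form F \<longrightarrow> ev (can F) t = F g 1" for g
  proof -
    have "pure (g, 1) +o xR.diamond_rel \<in> xR.canonical_map ` xR.op_tensor"
      using bij by (auto simp: bij_betw_def xR.diamond_def)
    then obtain t where "xR.canonical_map (t +o xR.op_tensor_rel) = pure (g, 1) +o xR.diamond_rel"
      by (auto simp: xR.op_tensor_def)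
    then show ?thesis unfolding canonical_map_eq_iff can_def by auto
  qed
  \<comment> \<open>By surjectivity, \<open>\<tau> g\<close> represents g_+ \<otimes> g_-, the
    preimage of g \<otimes> 1.\<close>
  then obtain \<tau> where \<tau>: "\<And>g F. diamond_form F \<Longrightarrow> ev (can F) (\<tau> g) = F g 1" by metis
  \<comment> \<open>The pullback of \<open>f\<close> along the inverse of \<beta>, extended from h =
    1 by right multiplication; \<open>T\<close> is the matching lift of the inverse to formal
    combinations.\<close>
  define hat where "hat f g h = ev (\<lambda>n p. f n (p * h)) (\<tau> g)" for f :: "'h \<Rightarrow> 'h \<Rightarrow> 'k" and g h
  define T where "T Y = lin_ext fscale (\<lambda>(g, h). lin_ext fscale (\<lambda>(n, p). pure (n, p * h)) (\<tau> g)) Y"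
    for Y :: "'h \<times> 'h \<Rightarrow>\<^sub>0 'k"
  have ev_T: "ev f (T Y) = ev (hat f) Y" for f Y
    by (simp add: T_def ev_lin_ext hat_def[abs_def])
  \<comment> \<open>\<beta> commutes with right multiplication on the second factor, which preserves
    forms on H \<diamond> H; so the property of \<open>\<tau>\<close> extends from 1 to
    \<open>h\<close>.\<close>
  have hat_can: "hat (can F) g h = F g h" if d: "diamond_form F" for F g h
  proof -
    have "hat (can F) g h = ev (can (\<lambda>a b. F a (b * h))) (\<tau> g)"
      by (simp add: hat_def can_def[abs_def] mult.assoc)
    also have "\<dots> = F g h" using \<tau>[OF diamond_form_mult_second[OF d]] by simp
    finally show ?thesis .
  qed
  have ev_can_T: "ev (can F) (T Y) = ev F Y" if "diamond_form F" for F Y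
    by (simp add: ev_T hat_can[OF that, abs_def])
  \<comment> \<open>If \<beta> sends \<open>y\<close> to \<open>Y\<close>, then \<open>T Y\<close>
    and \<open>y\<close> have the same image, hence agree by injectivity.\<close>
  have hat_lift: "ev (hat f) Y = ev f y"
    if "op_tensor_form f" "\<And>F. diamond_form F \<Longrightarrow> ev (can F) y = ev F Y" for f y Y
    unfolding ev_T[symmetric] by (rule inj) (use that ev_can_T in auto)
  have hat_cong: "ev (hat f) Y = ev (hat f) Y'"
    if "op_tensor_form f" "\<And>F. diamond_form F \<Longrightarrow> ev F Y = ev F Y'" for f Y Y'
    unfolding ev_T[of f Y', symmetric] by (rule hat_lift[OF that(1)]) (simp only: ev_can_T that(2))
  \<comment> \<open>The choice of \<open>\<tau>\<close> need not be linear; bilinearity and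
    balancing of \<open>hat f\<close> come from comparing formal combinations that coincide in H
    \<diamond> H.\<close>
  have diamond_form_hat: "diamond_form (hat f)" if n: "op_tensor_form f" for f
  proof (rule diamond_formI)
    have "bform scale F" if "diamond_form F" for F using that by (rule diamond_form_bform)
    note lin = lform_add[OF bform1[OF this]] lform_add[OF bform2[OF this]]
      lform_scale[OF bform1[OF this]] lform_scale[OF bform2[OF this]]
    show "bform scale (hat f)"
    proof (intro bformI)
      show "lform scale (\<lambda>a. hat f a b)" for b
        unfolding lform_def
        using hat_cong[OF n, of "pure (_ + _, b)" "pure (_, b) + pure (_, b)"]
          hat_cong[OF n, of "pure (scale _ _, b)" "fscale _ (pure (_, b))"]
        by (simp add: ev_add ev_fscale lin)
      show "lform scale (\<lambda>b. hat f a b)" for a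
        unfolding lform_def
        using hat_cong[OF n, of "pure (a, _ + _)" "pure (a, _) + pure (a, _)"]
          hat_cong[OF n, of "pure (a, scale _ _)" "fscale _ (pure (a, _))"]
        by (simp add: ev_add ev_fscale lin)
    qed
    show "hat f (\<epsilon>s' r * m) k = hat f m (\<epsilon>t r * k)" for r m k
      using hat_cong[OF n, of "pure (\<epsilon>s' r * m, k)" "pure (m, \<epsilon>t r * k)"]
      by (simp add: diamond_form_balanced)
  qed
  \<comment> \<open>The inverse of \<beta> applied to \<beta>(g \<otimes> h).\<close>
  have sw_hat: "sw g (\<lambda>a b. hat f a (b * h)) = f g h" if n: "op_tensor_form f" for f g h
  proof -
    let ?Y = "lin_ext fscale (\<lambda>(a, b). pure (a, b * h)) (rep (\<Delta> g))"
    have Y: "ev F ?Y = sw g (\<lambda>a b. F a (b * h))" for F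
      by (simp add: ev_lin_ext sw_def)
    have "ev (hat f) ?Y = ev f (pure (g, h))"
      by (rule hat_lift[OF n]) (simp add: Y can_def)
    then show ?thesis by (simp add: Y)
  qed
  \<comment> \<open>Balancing of \<open>f\<close> is imposed only between its last two
    arguments.\<close>
  have comodule: "ev (\<lambda>n p. sw n (\<lambda>a b. f a b p)) (\<tau> h) = sw h (\<lambda>a b. ev (f a) (\<tau> b))"
    if f: "tform scale f" and n: "\<And>a. op_tensor_form (f a)" for f h
  proof -
    note hb = diamond_form_hat[OF n, THEN diamond_form_bform]
    have hat1: "lform scale (\<lambda>a. hat (f a) b c)" for b c
      unfolding hat_def by (intro lin_intros) (rule tform1[OF f])
    note L = lin_intros lform_comp[OF hat1] lform_comp[OF bform1[OF hb]] lform_comp[OF bform2[OF hb]]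
    \<comment> \<open>This is f(g_1, g_2+, g_2- h). \<Delta> carries a left source factor to the
      second leg, where \<open>hat\<close> is balanced. The pullback along \<beta> is f(g_1, g_2,
      p), so evaluation at \<open>\<tau> h\<close> gives the claim.\<close>
    define \<Psi> where "\<Psi> g h = sw g (\<lambda>a b. hat (f a) b h)" for g h
    have "diamond_form \<Psi>"
      unfolding \<Psi>_def
    proof (rule diamond_formI)
      show "bform scale (\<lambda>g h. sw g (\<lambda>a b. hat (f a) b h))" by (intro L)
      have "bform scale (\<lambda>a b. hat (f a) b h)" for h by (intro L)
      from sw_mult_es_left[OF this, of "\<epsilon>s' _"]
      show "sw (\<epsilon>s' r * m) (\<lambda>a b. hat (f a) b k) = sw m (\<lambda>a b. hat (f a) b (\<epsilon>t r * k))" for r m k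
        by (simp add: diamond_form_balanced[OF diamond_form_hat[OF n]])
    qed
    have "can \<Psi> g p = sw g (\<lambda>a b. f a b p)" for g p
    proof -
      have "can \<Psi> g p = sw g (\<lambda>a b. sw a (\<lambda>c d. hat (f c) d (b * p)))"
        by (simp add: can_def \<Psi>_def)
      also have "\<dots> = sw g (\<lambda>a b. sw b (\<lambda>c d. hat (f a) c (d * p)))"
        by (rule sw_coassoc) (intro L)
      also have "\<dots> = sw g (\<lambda>a b. f a b p)"
        by (simp only: sw_hat[OF n])
      finally show ?thesis .
    qed
    then have "can \<Psi> = (\<lambda>n p. sw n (\<lambda>a b. f a b p))" by (intro ext)
    then have "ev (\<lambda>n p. sw n (\<lambda>a b. f a b p)) (\<tau> h) = \<Psi> h 1"
      using \<tau>[OF \<open>diamond_form \<Psi>\<close>, of h] by simp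
    then show ?thesis by (simp add: \<Psi>_def hat_def)
  qed
  define S where "S h = lin_ext scale (\<lambda>(n, p). \<epsilon>s n * p) (\<tau> h)" for h
  have S: "\<phi> (S h) = ev (\<lambda>n p. \<phi> (\<epsilon>s n * p)) (\<tau> h)" if "lform scale \<phi>" for \<phi> h
    unfolding S_def by (rule lform_expand[OF that])
  \<comment> \<open>\<open>\<epsilon>s\<close> is right linear over H_s, so the formula for
    \<open>S\<close> depends only on the class of \<open>\<tau> h\<close>.\<close>
  have nb: "op_tensor_form (\<lambda>n p. \<phi> (\<epsilon>s n * p))" if \<phi>: "lform scale \<phi>" for \<phi>
  proof (rule op_tensor_formI)
    show "\<phi> (\<epsilon>s (m * \<epsilon>s' r) * n) = \<phi> (\<epsilon>s m * (\<epsilon>s' r * n))" for r m n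
      using es_mult_es_right[of m "\<epsilon>s' r"] by (simp add: mult.assoc)
  qed (intro lin_intros lform_comp[OF \<phi>])
  have S_mult: "\<phi> (S g * k) = hat (\<lambda>n p. \<phi> (\<epsilon>s n * p)) g k" if \<phi>: "lform scale \<phi>" for \<phi> g k
  proof -
    have "lform scale (\<lambda>u. \<phi> (u * k))" by (intro lin_intros lform_comp[OF \<phi>])
    from S[OF this, of g] show ?thesis by (simp add: hat_def mult.assoc)
  qed
  have linS: "lmap scale S"
  proof (rule lmap_by_lforms)
    fix \<phi> :: "'h \<Rightarrow> 'k" assume \<phi>: "lform scale \<phi>"
    show "lform scale (\<lambda>a. \<phi> (S a))"
      using bform1[OF diamond_form_bform[OF diamond_form_hat[OF nb[OF \<phi>]]], of 1] S_mult[OF \<phi>, of _ 1] by simp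
  qed
  have S1: "sw h (\<lambda>a b. \<phi> (S a * b)) = \<phi> (\<epsilon>s h)" if \<phi>: "lform scale \<phi>" for \<phi> h
    using sw_hat[OF nb[OF \<phi>], of h 1] by (simp add: S_mult[OF \<phi>])
  \<comment> \<open>Stated for a general \<open>F\<close>: the identity serves the second antipode
    law, and \<open>\<epsilon>s\<close> the third.\<close>
  have comoduleS: "sw h (\<lambda>a b. \<phi> (F a * S b)) = ev (\<lambda>n p. sw n (\<lambda>a b. \<phi> (F a * \<epsilon>s b * p))) (\<tau> h)"
    if \<phi>: "lform scale \<phi>" and F: "lmap scale F" for \<phi> h F
  proof -
    note L = lin_intros lform_comp[OF \<phi>] lmap_comp[OF F]
    have m: "lform scale (\<lambda>u. \<phi> (F a * u))" for a by (intro L)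
    have "ev (\<lambda>n p. sw n (\<lambda>a b. \<phi> (F a * (\<epsilon>s b * p)))) (\<tau> h)
        = sw h (\<lambda>a b. ev (\<lambda>n p. \<phi> (F a * (\<epsilon>s n * p))) (\<tau> b))"
      by (rule comodule) (intro L, rule nb[OF m])
    then show ?thesis by (simp only: S[OF m] mult.assoc)
  qed
  have S2: "sw h (\<lambda>a b. \<phi> (a * S b)) = \<phi> (\<epsilon>t h)" if \<phi>: "lform scale \<phi>" for \<phi> h
  proof -
    note L = lin_intros lform_comp[OF \<phi>]
    \<comment> \<open>This form pulls back along \<beta> to \<epsilon>t(g_1) g_2 p = g p, so
      evaluation at \<open>\<tau> h\<close> gives h_+ h_- = \<epsilon>t(h).\<close>
    have "diamond_form (\<lambda>a b. \<phi> (\<epsilon>t a * b))"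
      by (rule diamond_formI) (intro L, simp add: et_es'_mult mult.assoc)
    from \<tau>[OF this, of h] have *: "ev (can (\<lambda>a b. \<phi> (\<epsilon>t a * b))) (\<tau> h) = \<phi> (\<epsilon>t h)" by simp
    have p: "lform scale (\<lambda>u. \<phi> (u * p))" for p by (intro L)
    have "can (\<lambda>a b. \<phi> (\<epsilon>t a * b)) = (\<lambda>n p. \<phi> (n * p))"
      using sw_et_mult[OF p] by (intro ext) (simp add: can_def mult.assoc)
    moreover have "sw n (\<lambda>a b. \<phi> (a * \<epsilon>s b * p)) = \<phi> (n * p)" for n p
      by (rule sw_mult_es[OF p])
    ultimately show ?thesis
      using comoduleS[OF \<phi> lmap_id, of h] * by simp
  qed
  have S3: "sw h (\<lambda>a b. sw a (\<lambda>c d. \<phi> (S c * d * S b))) = \<phi> (S h)" if \<phi>: "lform scale \<phi>" for \<phi> h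
  proof -
    note L = lin_intros lform_comp[OF \<phi>]
    have k: "lform scale (\<lambda>u. \<phi> (u * k))" for k by (intro L)
    have e: "lform scale (\<lambda>u. \<phi> (\<epsilon>s u * p))" for p by (intro L)
    \<comment> \<open>With S(h_1) h_2 replaced by \<open>\<epsilon>s\<close>, the claim reduces to
      \<epsilon>s(n_1) \<epsilon>s(n_2) = \<epsilon>s(n_1 \<epsilon>s(n_2)) = \<epsilon>s(n) for n =
      h_+.\<close>
    have "sw n (\<lambda>a b. \<phi> (\<epsilon>s a * \<epsilon>s b * p)) = \<phi> (\<epsilon>s n * p)" for n p
      using sw_mult_es[OF e, of n p] by (simp only: es_mult_es_right)
    then show ?thesis
      using comoduleS[OF \<phi> lmap_es0, of h] by (simp add: S1[OF k] S[OF \<phi>])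
  qed
  show ?thesis
    using linS S1 S2 S3 unfolding is_antipode_iff by blast
qed

end

theorem corollary6p2:
  fixes scale :: "'k::field \<Rightarrow> 'h::{ring, monoid_mult} \<Rightarrow> 'h"
    and \<Delta> :: "'h \<Rightarrow> ('h \<times> 'h \<Rightarrow>\<^sub>0 'k) set" and \<epsilon> :: "'h \<Rightarrow> 'k"
  assumes "weak_bialgebra scale \<Delta> \<epsilon>"
  shows "weak_hopf_algebra scale \<Delta> \<epsilon> \<longleftrightarrow>
    xR_hopf_algebra scale (counital_maps.target_subalgebra scale \<Delta> \<epsilon>) scale
      (counital_maps.assoc_eta scale \<Delta> \<epsilon>)
      (counital_maps.assoc_Gamma scale \<Delta> \<epsilon>)
      (counital_maps.assoc_C scale \<Delta> \<epsilon>)"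
proof -
  interpret weak_bialgebra scale \<Delta> \<epsilon> by (fact assms)
  \<comment> \<open>The associated structure is always a bialgebra over H_t, so the equivalence
    concerns only bijectivity of the canonical map.\<close>
  show ?thesis
    unfolding weak_hopf_iff xR_hopf_algebra_def xR_hopf_algebra_axioms_def
    using assoc_xR_bialgebra canonical_bij_if_antipode antipode_if_canonical_bij by blast
qed

end
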